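(* Let $d\ge1$, $0<p<1$, $b>0$. For every real $\alpha\ge 0$ with $\alpha\ne M$, the limit $$\lambda(\alpha)=\lambda(\alpha,p):=\lim_{t\to\infty}[N_t(\alpha)]^{1/t}$$ exists almost surely and is almost surely equal to a constant.
   Context: $\mathcal L$ is the directed graph with vertex set $\mathbb Z^d\times\mathbb Z_+$ ($\mathbb Z_+=\{0,1,2,\dots\}$) in which each vertex $v$ has exactly $2d$ outgoing edges, namely to $v\pm e_i+e_{d+1}$ for $1\le i\le d$, where $e_i$ is the $i$-th coordinate vector. $\mathbf 0$ denotes the origin. An oriented path of length $s$ is a sequence $\pi=(\pi_0,\pi_1,\dots,\pi_s)$ of vertices such that there is a directed edge of $\mathcal L$ from $\pi_{i}$ to $\pi_{i+1}$ for $0\le i<s$; we write $|\pi|=s$. The random variables $\{X(v): v\in\mathbb Z^d\times\mathbb Z_+\}$ are i.i.d. with $P\{X(v)=e^b\}=p$, $P\{X(v)=1\}=1-p$. For a path $\pi$ of length $s$, $W(\pi)$ is the number of indices $i$ with $1\le i\le s$ and $X(\pi_i)=e^b$ (the starting vertex $\pi_0$ is not counted). For real $\alpha\ge0$, $N_s(\alpha)$ is the number of oriented paths $\pi$ of length $s$ with $\pi_0=\mathbf 0$ and $W(\pi)\ge\alpha s$. Finally $M=M(p):=\lim_{s\to\infty}\max_{\pi_0=\mathbf 0,|\pi|=s}\frac1s W(\pi)$, the maximum being over oriented paths of length $s$ starting at $\mathbf 0$; this limit exists almost surely and is almost surely a constant. *)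

theory Defs
  imports "HOL-Probability.Probability"
begin

text \<open>
  The dimension is \<open>d = CARD('d)\<close>, hence automatically at least 1. The second component of a
  vertex is its last coordinate, in \<open>\<int>\<^sub>+\<close>.
\<close>

type_synonym 'd vertex = "(int ^ 'd) \<times> nat"

definition edge :: "('d::finite) vertex \<Rightarrow> 'd vertex \<Rightarrow> bool" where
  "edge u v \<longleftrightarrow> snd v = Suc (snd u) \<and>
     (\<exists>i. fst v = fst u + axis i 1 \<or> fst v = fst u - axis i 1)"

definition origin :: "('d::finite) vertex" where
  "origin = (0, 0)"

text \<open>A path of length \<open>s\<close> is the list of its \<open>s + 1\<close> vertices.\<close>

definition oriented_path :: "nat \<Rightarrow> ('d::finite) vertex list \<Rightarrow> bool" where
  "oriented_path s \<pi> \<longleftrightarrow> length \<pi> = Suc s \<and> (\<forall>i<s. edge (\<pi> ! i) (\<pi> ! Suc i))"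

definition paths :: "nat \<Rightarrow> ('d::finite) vertex list set" where
  "paths s = {\<pi>. oriented_path s \<pi> \<and> \<pi> ! 0 = origin}"

text \<open>
  Below, \<open>x\<close> is a realisation \<open>\<lambda>v. X v \<omega>\<close> of the environment. The starting vertex \<open>\<pi> ! 0\<close> is not
  counted by \<open>W\<close>.
\<close>

definition W :: "real \<Rightarrow> (('d::finite) vertex \<Rightarrow> real) \<Rightarrow> 'd vertex list \<Rightarrow> nat" where
  "W b x \<pi> = card {i. 1 \<le> i \<and> i < length \<pi> \<and> x (\<pi> ! i) = exp b}"

definition N :: "real \<Rightarrow> (('d::finite) vertex \<Rightarrow> real) \<Rightarrow> nat \<Rightarrow> real \<Rightarrow> nat" where
  "N b x s \<alpha> = card {\<pi> \<in> paths s. real (W b x \<pi>) \<ge> \<alpha> * real s}"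

definition max_density :: "real \<Rightarrow> (('d::finite) vertex \<Rightarrow> real) \<Rightarrow> nat \<Rightarrow> real" where
  "max_density b x s = Max ((\<lambda>\<pi>. 1 / real s * real (W b x \<pi>)) ` paths s)"

definition M_const :: "'w measure \<Rightarrow> real \<Rightarrow> (('d::finite) vertex \<Rightarrow> 'w \<Rightarrow> real) \<Rightarrow> real" where
  "M_const P b X =
     (THE m. AE \<omega> in P. (\<lambda>s. max_density b (\<lambda>v. X v \<omega>) s) \<longlonglongrightarrow> m)"

lemma M_const_eqI:
  assumes "prob_space P"
    and lim: "AE \<omega> in P. (\<lambda>s. max_density b (\<lambda>v. X v \<omega>) s) \<longlonglongrightarrow> m"
  shows "M_const P b X = m"
  unfolding M_const_def
proof (rule the_equality[where P = "\<lambda>m. AE \<omega> in P. (\<lambda>s. max_density b (\<lambda>v. X v \<omega>) s) \<longlonglongrightarrow> m"])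
  fix m'
  assume "AE \<omega> in P. (\<lambda>s. max_density b (\<lambda>v. X v \<omega>) s) \<longlonglongrightarrow> m'"
  with lim have "AE \<omega> in P. m' = m"
    by eventually_elim (rule LIMSEQ_unique)
  then show "m' = m"
    using prob_space.AE_const[OF assms(1)] by simp
qed (fact lim)

text \<open>
  The sets in \<open>N\<close> and \<open>max_density\<close> are finite and nonempty, so \<open>card\<close> and \<open>Max\<close> have their
  intended values.
\<close>

lemma paths_0: "paths 0 = {[origin]}"
  by (auto simp: paths_def oriented_path_def length_Suc_conv)

lemma paths_Suc: "paths (Suc s) = {\<pi> @ [v] |\<pi> v. \<pi> \<in> paths s \<and> edge (last \<pi>) v}"
proof (intro set_eqI iffI)
  fix \<rho> :: "'a vertex list"
  assume "\<rho> \<in> paths (Suc s)"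
  then have len: "length \<rho> = Suc (Suc s)"
    and e: "\<And>i. i < Suc s \<Longrightarrow> edge (\<rho> ! i) (\<rho> ! Suc i)" and o: "\<rho> ! 0 = origin"
    by (auto simp: paths_def oriented_path_def)
  from len obtain \<pi> v where \<rho>: "\<rho> = \<pi> @ [v]" and l: "length \<pi> = Suc s"
    by (metis length_Suc_conv_rev)
  have "edge (\<pi> ! i) (\<pi> ! Suc i)" if "i < s" for i
    using e[of i] that l by (simp add: \<rho> nth_append)
  moreover have "edge (last \<pi>) v"
  proof -
    have "\<pi> \<noteq> []" using l by auto
    then show ?thesis using e[of s] l by (simp add: \<rho> nth_append last_conv_nth)
  qed
  moreover have "\<pi> ! 0 = origin"
    using o l by (simp add: \<rho> nth_append)
  ultimately have "\<pi> \<in> paths s \<and> edge (last \<pi>) v"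
    using l by (simp add: paths_def oriented_path_def)
  then show "\<rho> \<in> {\<pi> @ [v] |\<pi> v. \<pi> \<in> paths s \<and> edge (last \<pi>) v}"
    using \<rho> by blast
next
  fix \<rho> :: "'a vertex list"
  assume "\<rho> \<in> {\<pi> @ [v] |\<pi> v. \<pi> \<in> paths s \<and> edge (last \<pi>) v}"
  then obtain \<pi> v where \<rho>: "\<rho> = \<pi> @ [v]" and l: "length \<pi> = Suc s"
    and e: "\<And>i. i < s \<Longrightarrow> edge (\<pi> ! i) (\<pi> ! Suc i)" and o: "\<pi> ! 0 = origin"
    and ev: "edge (last \<pi>) v"
    by (auto simp: paths_def oriented_path_def)
  have "\<pi> \<noteq> []" using l by auto
  then have "edge (\<pi> ! s) v" using ev l by (simp add: last_conv_nth)
  then show "\<rho> \<in> paths (Suc s)"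
    using l e o by (auto simp: \<rho> paths_def oriented_path_def nth_append less_Suc_eq)
qed

lemma finite_edges: "finite {v. edge u v}"
proof (rule finite_subset)
  show "{v. edge u v} \<subseteq> range (\<lambda>i. (fst u + axis i 1, Suc (snd u))) \<union>
      range (\<lambda>i. (fst u - axis i 1, Suc (snd u)))"
    by (force simp: edge_def prod_eq_iff)
qed auto

lemma finite_paths: "finite (paths s :: ('d::finite) vertex list set)"
proof (induction s)
  case (Suc s)
  have "(paths (Suc s) :: 'd vertex list set) = (\<Union>\<pi>\<in>paths s. (\<lambda>v. \<pi> @ [v]) ` {v. edge (last \<pi>) v})"
    unfolding paths_Suc by auto
  then show ?case
    by (simp only:) (intro finite_UN_I finite_imageI Suc.IH finite_edges)
qed (simp add: paths_0)

lemma paths_nonempty: "(paths s :: ('d::finite) vertex list set) \<noteq> {}"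
proof (induction s)
  case (Suc s)
  then obtain \<pi> :: "'d vertex list" where "\<pi> \<in> paths s" by blast
  moreover have "edge (last \<pi>) (fst (last \<pi>) + axis undefined 1, Suc (snd (last \<pi>)))"
    by (auto simp: edge_def)
  ultimately show ?case unfolding paths_Suc by blast
qed (simp add: paths_0)

end

theory Submission
  imports Defs
begin

text \<open>
  The hard constraint \<open>W \<ge> \<alpha>t\<close> makes \<open>ln N\<close> unstable: one bad level of the environment can send it to
  \<open>-\<infinity>\<close>. The proof replaces it by a soft one. For \<open>K \<ge> 0\<close> let \<open>Z\<^sub>K(t, \<alpha>)\<close> be the sum of
  \<open>exp (- K (\<alpha>t - W(\<pi>))\<^sup>+)\<close> over the paths \<open>\<pi>\<close> of length \<open>t\<close> from the origin. The soft count has two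
  properties that \<open>N\<close> lacks.

  \<^item> Changing the environment on one level changes each \<open>W(\<pi>)\<close> by at most 1, hence \<open>ln Z\<^sub>K\<close> by at most
    \<open>K\<close>. As levels are independent, the variance of \<open>ln Z\<^sub>K(t, \<alpha>)\<close> is at most of order \<open>t\<close>.
  \<^item> The positive part is subadditive, so concatenating paths and applying Jensen's inequality to
    the distribution of the first part shows that the expectation of \<open>ln Z\<^sub>K\<close> is superadditive, in \<open>t\<close>
    and simultaneously in the threshold \<open>\<alpha>t\<close>.

  Superadditivity gives a limit \<open>\<phi>\<^sub>K(\<alpha>)\<close> of the expectation of \<open>ln Z\<^sub>K(t, \<alpha>) / t\<close>, which is midpoint
  concave in \<open>\<alpha>\<close>; the variance bound gives almost sure convergence along \<open>t = n\<^sup>2\<close>, and the increments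
  of \<open>ln Z\<^sub>K\<close> are bounded from below well enough to fill the gaps (\<open>AE_log_count_tendsto_soft_rate\<close>).

  The case \<open>\<alpha> = 1\<close> shows that \<open>max W / t\<close> converges: since \<open>W \<le> t\<close>, the quantity
  \<open>ln Z\<^sub>K(t, 1) / (Kt) + 1\<close> differs from it by at most \<open>ln (2d) / K\<close> (\<open>AE_max_hits_tendsto\<close>). This
  identifies \<open>M\<close>. If \<open>\<alpha> > M\<close>, then \<open>N\<close> is eventually 0.

  Let \<open>\<alpha> < M\<close>. Trivially \<open>N \<le> Z\<^sub>K(t, \<alpha>)\<close> for every \<open>K\<close>. Conversely, if \<open>\<alpha> < \<alpha>' < M\<close>, the paths that violate
  \<open>W \<ge> \<alpha>t\<close> contribute at most \<open>(2d)\<^sup>t exp (- K(\<alpha>' - \<alpha>)t)\<close> to \<open>Z\<^sub>K(t, \<alpha>')\<close>, which is negligible for large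
  \<open>K\<close> because \<open>\<phi>\<^sub>K(\<alpha>') \<ge> 0\<close>. So \<open>ln N / t\<close> lies asymptotically between
  \<open>inf\<^sub>K \<phi>\<^sub>K(\<alpha>')\<close> and \<open>inf\<^sub>K \<phi>\<^sub>K(\<alpha>)\<close>. Midpoint concavity together with nonnegativity to the right of \<open>\<alpha>\<close>
  makes the two agree as \<open>\<alpha>'\<close> decreases to \<open>\<alpha>\<close>, uniformly in \<open>K\<close> (\<open>soft_rate_dyadic\<close>).
\<close>

section \<open>Independent, identically distributed environments\<close>

definition iid :: "'b pmf \<Rightarrow> ('i \<Rightarrow> 'b) measure" where
  "iid q = PiM UNIV (\<lambda>_. measure_pmf q)"

definition depends_only_on :: "(('i \<Rightarrow> 'b) \<Rightarrow> 'c) \<Rightarrow> 'i set \<Rightarrow> bool" where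
  "depends_only_on f A \<longleftrightarrow> (\<forall>\<omega> \<omega>'. (\<forall>i\<in>A. \<omega> i = \<omega>' i) \<longrightarrow> f \<omega> = f \<omega>')"

lemma space_iid [simp]: "space (iid q) = UNIV"
  by (simp add: iid_def space_PiM)

lemma prob_space_iid: "prob_space (iid q)"
  unfolding iid_def by (intro prob_space_PiM measure_pmf.prob_space_axioms)

lemma measurable_iid_coordinate [measurable]: "(\<lambda>\<omega>. \<omega> i) \<in> measurable (iid q) (count_space UNIV)"
proof -
  have "(\<lambda>\<omega>. \<omega> i) \<in> measurable (iid q) (measure_pmf q)"
    unfolding iid_def by (rule measurable_component_singleton) simp
  then show ?thesis by simp
qed

lemma measurable_into_iid:
  assumes "\<And>i. (\<lambda>x. f x i) \<in> measurable M (count_space UNIV)"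
  shows "f \<in> measurable M (iid q)"
proof -
  have "(\<lambda>x i. f x i) \<in> measurable M (iid q)"
    unfolding iid_def
  proof (rule measurable_abs_UNIV)
    fix i show "(\<lambda>x. f x i) \<in> measurable M (measure_pmf q)"
      using assms[of i] by simp
  qed
  then show ?thesis by simp
qed

lemma measurable_reindex: "(\<lambda>\<omega> j. \<omega> (f j)) \<in> measurable (iid q) (iid q)"
  by (rule measurable_into_iid) measurable

lemma distr_iid_reindex:
  assumes "inj f"
  shows "distr (iid q) (iid q) (\<lambda>\<omega> j. \<omega> (f j)) = iid q"
proof -
  have "distr (PiM UNIV (\<lambda>_. measure_pmf q)) (PiM UNIV (\<lambda>_. measure_pmf q))
     (\<lambda>\<omega>. \<lambda>n\<in>UNIV. \<omega> (f n)) = PiM UNIV (\<lambda>_. measure_pmf q)"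
    by (rule distr_PiM_reindex[of UNIV "\<lambda>_. measure_pmf q" f UNIV])
       (use assms measure_pmf.prob_space_axioms in auto)
  then show ?thesis by (simp add: iid_def restrict_def)
qed

text \<open>
  Injective reindexing is the single source of symmetry below: it gives translation invariance, the
  marginals of a pair of independent copies, and the exchange of one level between the two copies.
\<close>

lemma integral_iid_reindex:
  fixes G :: "('j \<Rightarrow> 'b) \<Rightarrow> real"
  assumes "inj f" "G \<in> borel_measurable (iid q)"
  shows "(\<integral>\<omega>. G (\<lambda>j. \<omega> (f j)) \<partial>iid q) = (\<integral>\<omega>. G \<omega> \<partial>iid q)"
  using integral_distr[OF measurable_reindex assms(2), of f] distr_iid_reindex[OF assms(1), of q] by simp

lemma integrable_iid_bounded:
  fixes f :: "('i \<Rightarrow> 'b) \<Rightarrow> real"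
  assumes "f \<in> borel_measurable (iid q)" "\<And>\<omega>. \<bar>f \<omega>\<bar> \<le> B"
  shows "integrable (iid q) f"
proof -
  interpret prob_space "iid q" by (rule prob_space_iid)
  show ?thesis by (rule integrable_const_bound[where B = B]) (use assms in auto)
qed

lemma indep_vars_iid_coordinates:
  "prob_space.indep_vars (iid q) (\<lambda>_. measure_pmf q) (\<lambda>i \<omega>. \<omega> i) UNIV"
proof -
  interpret prob_space "iid q" by (rule prob_space_iid)
  have "distr (iid q) (PiM UNIV (\<lambda>_. measure_pmf q)) (\<lambda>x. \<lambda>i\<in>UNIV. x i)
    = (\<Pi>\<^sub>M i\<in>UNIV. distr (iid q) (measure_pmf q) (\<lambda>\<omega>. \<omega> i))"
    unfolding iid_def by (subst distr_PiM_component) (simp_all add: measure_pmf.prob_space_axioms restrict_def distr_id)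
  then show ?thesis
    by (subst indep_vars_iff_distr_eq_PiM) auto
qed

text \<open>
  Functions of disjoint sets of coordinates are independent; each factors through the restriction of
  the environment to its set.
\<close>

lemma integral_iid_mult:
  fixes f g :: "('i \<Rightarrow> 'b) \<Rightarrow> real"
  assumes f: "f \<in> borel_measurable (iid q)" "depends_only_on f A" "\<And>\<omega>. \<bar>f \<omega>\<bar> \<le> Bf"
    and g: "g \<in> borel_measurable (iid q)" "depends_only_on g B" "\<And>\<omega>. \<bar>g \<omega>\<bar> \<le> Bg"
    and disj: "A \<inter> B = {}"
  shows "(\<integral>\<omega>. f \<omega> * g \<omega> \<partial>iid q) = (\<integral>\<omega>. f \<omega> \<partial>iid q) * (\<integral>\<omega>. g \<omega> \<partial>iid q)"
proof -
  interpret prob_space "iid q :: ('i \<Rightarrow> 'b) measure" by (rule prob_space_iid)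
  define fill :: "'i set \<Rightarrow> ('i \<Rightarrow> 'b) \<Rightarrow> 'i \<Rightarrow> 'b" where
    "fill C \<omega> = (\<lambda>i. if i \<in> C then \<omega> i else undefined)" for C \<omega>
  have fill: "fill C \<in> measurable (PiM C (\<lambda>_. measure_pmf q)) (iid q)" for C
    unfolding fill_def
  proof (rule measurable_into_iid)
    fix i
    have "(\<lambda>x. x i) \<in> measurable (PiM C (\<lambda>_. measure_pmf q)) (measure_pmf q)" if "i \<in> C"
      by (rule measurable_component_singleton[OF that])
    then show "(\<lambda>x. if i \<in> C then x i else undefined)
        \<in> measurable (PiM C (\<lambda>_. measure_pmf q)) (count_space UNIV)"
      by (cases "i \<in> C") auto
  qed
  have eq: "h (fill C (restrict \<omega> C)) = h \<omega>" if "depends_only_on h C" for h :: "('i \<Rightarrow> 'b) \<Rightarrow> real" and C \<omega>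
    by (rule that[unfolded depends_only_on_def, rule_format]) (simp add: fill_def)
  have "indep_var (PiM A (\<lambda>_. measure_pmf q)) (\<lambda>\<omega>. restrict (\<lambda>i. \<omega> i) A)
      (PiM B (\<lambda>_. measure_pmf q)) (\<lambda>\<omega>. restrict (\<lambda>i. \<omega> i) B)"
    by (rule indep_var_restrict[OF indep_vars_iid_coordinates disj]) auto
  then have "indep_var borel ((f \<circ> fill A) \<circ> (\<lambda>\<omega>. restrict (\<lambda>i. \<omega> i) A))
      borel ((g \<circ> fill B) \<circ> (\<lambda>\<omega>. restrict (\<lambda>i. \<omega> i) B))"
    by (rule indep_var_compose) (use fill f(1) g(1) in \<open>auto intro: measurable_comp\<close>)
  moreover have "(f \<circ> fill A) \<circ> (\<lambda>\<omega>. restrict (\<lambda>i. \<omega> i) A) = f"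
    "(g \<circ> fill B) \<circ> (\<lambda>\<omega>. restrict (\<lambda>i. \<omega> i) B) = g"
    using eq[OF f(2)] eq[OF g(2)] by (auto simp: fun_eq_iff)
  ultimately have "indep_var borel f borel g" by simp
  then show ?thesis
    by (rule indep_var_lebesgue_integral)
       (use integrable_iid_bounded[OF f(1,3)] integrable_iid_bounded[OF g(1,3)] in auto)
qed

text \<open>
  An Efron--Stein bound without conditional expectations. Let \<open>T\<close> and \<open>U\<close> be independent copies of the
  environment, so that the variance is the expectation of \<open>f T * (f T - f U)\<close>. Passing from \<open>T\<close> to \<open>U\<close>
  level by level splits \<open>f T - f U\<close> into \<open>n\<close> increments. Exchanging level \<open>k\<close> of the two copies
  preserves the joint law and reverses the sign of the \<open>k\<close>-th increment, which replaces the factor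
  \<open>f T\<close> by half of a difference of \<open>f\<close> across one level; so each increment contributes at most \<open>c\<^sup>2 / 2\<close>.
  Both copies are realised in one environment indexed by \<open>'i \<times> bool\<close>.
\<close>

lemma variance_bounded_differences:
  fixes f :: "('i \<Rightarrow> 'b) \<Rightarrow> real" and level :: "'i \<Rightarrow> nat"
  assumes meas: "f \<in> borel_measurable (iid q)" and bounded: "\<And>\<omega>. \<bar>f \<omega>\<bar> \<le> B"
    and dep: "depends_only_on f {i. level i < n}"
    and diff: "\<And>k \<omega> \<omega>'. (\<And>i. level i \<noteq> k \<Longrightarrow> \<omega> i = \<omega>' i) \<Longrightarrow> \<bar>f \<omega> - f \<omega>'\<bar> \<le> c"
  shows "(\<integral>\<omega>. (f \<omega> - (\<integral>\<omega>'. f \<omega>' \<partial>iid q))\<^sup>2 \<partial>iid q) \<le> real n * c\<^sup>2"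
proof -
  let ?D = "iid q :: ('i \<times> bool \<Rightarrow> 'b) measure"
  interpret D: prob_space ?D by (rule prob_space_iid)
  interpret S: prob_space "iid q :: ('i \<Rightarrow> 'b) measure" by (rule prob_space_iid)
  have c: "c \<ge> 0" using diff[of 0 undefined undefined] by simp
  have B: "B \<ge> 0" using bounded[of undefined] by linarith
  define copy :: "bool \<Rightarrow> ('i \<times> bool \<Rightarrow> 'b) \<Rightarrow> 'i \<Rightarrow> 'b" where "copy b \<zeta> = (\<lambda>i. \<zeta> (i, b))" for b \<zeta>
  define mix :: "nat \<Rightarrow> ('i \<times> bool \<Rightarrow> 'b) \<Rightarrow> 'i \<Rightarrow> 'b" where
    "mix k \<zeta> = (\<lambda>i. \<zeta> (i, \<not> level i < k))" for k \<zeta>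
  define sw :: "nat \<Rightarrow> 'i \<times> bool \<Rightarrow> 'i \<times> bool" where
    "sw k = (\<lambda>(i, b). (i, if level i = k then \<not> b else b))" for k
  have meas_re: "(\<lambda>\<zeta>. f (\<lambda>j. \<zeta> (r j))) \<in> borel_measurable ?D" for r
    using measurable_compose[OF measurable_reindex meas] .
  have m1[measurable]: "(\<lambda>\<zeta>. f (copy b \<zeta>)) \<in> borel_measurable ?D" for b
    unfolding copy_def by (rule meas_re)
  have m2[measurable]: "(\<lambda>\<zeta>. f (mix k \<zeta>)) \<in> borel_measurable ?D" for k
    unfolding mix_def by (rule meas_re)
  have bdiff: "\<bar>f x - f y\<bar> \<le> 2 * B" for x y using bounded[of x] bounded[of y] by linarith
  \<comment> \<open>The bound \<open>c\<^sup>2\<close> is generous by a factor of 2.\<close>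
  have swap: "(\<integral>\<zeta>. f (copy True \<zeta>) * (f (mix k \<zeta>) - f (mix (Suc k) \<zeta>)) \<partial>?D) \<le> c\<^sup>2" for k
  proof -
    let ?H = "\<lambda>\<zeta>. f (copy True \<zeta>) * (f (mix k \<zeta>) - f (mix (Suc k) \<zeta>))"
    let ?re = "\<lambda>\<zeta> j. \<zeta> (sw k j) :: 'b"
    have inj: "inj (sw k)" by (auto simp: inj_def sw_def split: if_splits)
    have Hm: "?H \<in> borel_measurable ?D" by measurable
    have Hb: "\<bar>?H \<zeta>\<bar> \<le> B * (2 * B)" for \<zeta>
      unfolding abs_mult by (intro mult_mono bounded bdiff B) auto
    have I1: "integrable ?D ?H" by (rule integrable_iid_bounded[OF Hm Hb])
    have I2: "integrable ?D (\<lambda>\<zeta>. ?H (?re \<zeta>))"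
      by (rule integrable_iid_bounded[OF measurable_compose[OF measurable_reindex Hm] Hb])
    have mixre: "mix k (?re \<zeta>) = mix (Suc k) \<zeta>" "mix (Suc k) (?re \<zeta>) = mix k \<zeta>" for \<zeta>
      by (auto simp: mix_def sw_def fun_eq_iff less_Suc_eq)
    have "2 * (\<integral>\<zeta>. ?H \<zeta> \<partial>?D) = (\<integral>\<zeta>. ?H \<zeta> + ?H (?re \<zeta>) \<partial>?D)"
      using integral_iid_reindex[OF inj Hm] I1 I2 by simp
    also have "\<dots> \<le> (\<integral>\<zeta>. c * c \<partial>?D)"
    proof (rule integral_mono)
      fix \<zeta>
      have "?H \<zeta> + ?H (?re \<zeta>)
          = (f (copy True \<zeta>) - f (copy True (?re \<zeta>))) * (f (mix k \<zeta>) - f (mix (Suc k) \<zeta>))"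
        by (simp add: mixre algebra_simps)
      also have "\<dots> \<le> \<bar>f (copy True \<zeta>) - f (copy True (?re \<zeta>))\<bar> * \<bar>f (mix k \<zeta>) - f (mix (Suc k) \<zeta>)\<bar>"
        by (metis abs_ge_self abs_mult)
      also have "\<dots> \<le> c * c"
        by (intro mult_mono diff[where k = k] c) (auto simp: copy_def sw_def mix_def less_Suc_eq)
      finally show "?H \<zeta> + ?H (?re \<zeta>) \<le> c * c" .
    qed (use I1 I2 in auto)
    finally have "2 * (\<integral>\<zeta>. ?H \<zeta> \<partial>?D) \<le> c * c" using D.prob_space by simp
    moreover have "0 \<le> c * c" by simp
    ultimately show ?thesis unfolding power2_eq_square by linarith
  qed
  have int_re: "(\<integral>\<zeta>. G (copy b \<zeta>) \<partial>?D) = (\<integral>\<omega>. G \<omega> \<partial>iid q)"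
    if "G \<in> borel_measurable (iid q)" for G :: "('i \<Rightarrow> 'b) \<Rightarrow> real" and b
    unfolding copy_def by (rule integral_iid_reindex[OF _ that]) (auto simp: inj_def)
  have ff: "\<bar>f x * f y\<bar> \<le> B * B" for x y unfolding abs_mult by (intro mult_mono bounded B) auto
  have fI: "integrable (iid q) f" by (rule integrable_iid_bounded[OF meas bounded])
  have f2I: "integrable (iid q) (\<lambda>\<omega>. f \<omega> * f \<omega>)"
    by (rule integrable_iid_bounded[OF _ ff]) (use meas in measurable)
  define e where "e = (\<integral>\<omega>. f \<omega> \<partial>iid q)"
  have "(\<integral>\<omega>. (f \<omega> - e)\<^sup>2 \<partial>iid q) = (\<integral>\<omega>. f \<omega> * f \<omega> - 2 * e * f \<omega> + e * e \<partial>iid q)"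
    by (rule Bochner_Integration.integral_cong[OF refl]) (simp add: power2_eq_square algebra_simps)
  also have "\<dots> = (\<integral>\<omega>. f \<omega> * f \<omega> \<partial>iid q) - 2 * e * e + e * e"
    using fI f2I S.prob_space by (simp add: e_def[symmetric])
  also have "\<dots> = (\<integral>\<omega>. f \<omega> * f \<omega> \<partial>iid q) - e * e" by simp
  also have "(\<integral>\<omega>. f \<omega> * f \<omega> \<partial>iid q) = (\<integral>\<zeta>. f (copy True \<zeta>) * f (copy True \<zeta>) \<partial>?D)"
    by (rule int_re[symmetric]) (use meas in measurable)
  also have "e * e = (\<integral>\<zeta>. f (copy True \<zeta>) * f (copy False \<zeta>) \<partial>?D)"
  proof -
    have dep': "depends_only_on (\<lambda>\<zeta>. f (copy b \<zeta>)) (range (\<lambda>i. (i, b)))" for b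
      unfolding depends_only_on_def copy_def
    proof (intro allI impI)
      fix \<zeta> \<zeta>' :: "'i \<times> bool \<Rightarrow> 'b" assume "\<forall>i\<in>range (\<lambda>i. (i, b)). \<zeta> i = \<zeta>' i"
      then have "(\<lambda>i. \<zeta> (i, b)) = (\<lambda>i. \<zeta>' (i, b))" by auto
      then show "f (\<lambda>i. \<zeta> (i, b)) = f (\<lambda>i. \<zeta>' (i, b))" by simp
    qed
    have "(\<integral>\<zeta>. f (copy True \<zeta>) * f (copy False \<zeta>) \<partial>?D)
       = (\<integral>\<zeta>. f (copy True \<zeta>) \<partial>?D) * (\<integral>\<zeta>. f (copy False \<zeta>) \<partial>?D)"
      by (rule integral_iid_mult[OF m1 dep' bounded m1 dep' bounded]) auto
    then show ?thesis using int_re[OF meas] by (simp add: e_def)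
  qed
  also have "(\<integral>\<zeta>. f (copy True \<zeta>) * f (copy True \<zeta>) \<partial>?D) - (\<integral>\<zeta>. f (copy True \<zeta>) * f (copy False \<zeta>) \<partial>?D)
      = (\<integral>\<zeta>. f (copy True \<zeta>) * f (copy True \<zeta>) - f (copy True \<zeta>) * f (copy False \<zeta>) \<partial>?D)"
    by (rule Bochner_Integration.integral_diff[symmetric]; rule integrable_iid_bounded[OF _ ff]) measurable
  also have "\<dots> = (\<integral>\<zeta>. (\<Sum>k<n. f (copy True \<zeta>) * (f (mix k \<zeta>) - f (mix (Suc k) \<zeta>))) \<partial>?D)"
  proof (rule Bochner_Integration.integral_cong[OF refl])
    fix \<zeta>
    have "mix 0 \<zeta> = copy True \<zeta>" by (simp add: mix_def copy_def)
    moreover have "f (mix n \<zeta>) = f (copy False \<zeta>)"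
      using dep unfolding depends_only_on_def by (simp add: mix_def copy_def)
    ultimately have "(\<Sum>k<n. f (mix k \<zeta>) - f (mix (Suc k) \<zeta>)) = f (copy True \<zeta>) - f (copy False \<zeta>)"
      using sum_lessThan_telescope'[of "\<lambda>k. f (mix k \<zeta>)" n] by simp
    then show "f (copy True \<zeta>) * f (copy True \<zeta>) - f (copy True \<zeta>) * f (copy False \<zeta>)
      = (\<Sum>k<n. f (copy True \<zeta>) * (f (mix k \<zeta>) - f (mix (Suc k) \<zeta>)))"
      by (simp only: sum_distrib_left[symmetric] right_diff_distrib[symmetric])
  qed
  also have "\<dots> = (\<Sum>k<n. \<integral>\<zeta>. f (copy True \<zeta>) * (f (mix k \<zeta>) - f (mix (Suc k) \<zeta>)) \<partial>?D)"
  proof (rule Bochner_Integration.integral_sum)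
    fix k
    show "integrable ?D (\<lambda>\<zeta>. f (copy True \<zeta>) * (f (mix k \<zeta>) - f (mix (Suc k) \<zeta>)))"
    proof (rule integrable_iid_bounded[where B = "B * (2 * B)"])
      show "\<bar>f (copy True \<zeta>) * (f (mix k \<zeta>) - f (mix (Suc k) \<zeta>))\<bar> \<le> B * (2 * B)" for \<zeta>
        unfolding abs_mult by (intro mult_mono bounded bdiff B) auto
    qed measurable
  qed
  also have "\<dots> \<le> (\<Sum>k<n. c\<^sup>2)" by (intro sum_mono swap)
  finally show ?thesis by (simp add: e_def)
qed

text \<open>
  This reduces almost sure statements on \<open>P\<close> to the canonical Bernoulli environment, where the
  reindexings above are available.
\<close>

lemma distr_indep_indicators:
  fixes A :: "'i \<Rightarrow> 'b set"
  assumes "prob_space P" and indep: "prob_space.indep_vars P (\<lambda>_. M) X UNIV"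
    and A: "\<And>i. {x \<in> space M. x = c} \<in> sets M"
    and prob: "\<And>i. measure P {\<omega> \<in> space P. X i \<omega> = c} = p"
  shows "(\<lambda>\<omega> i. X i \<omega> = c) \<in> measurable P (iid (bernoulli_pmf p))"
    and "distr P (iid (bernoulli_pmf p)) (\<lambda>\<omega> i. X i \<omega> = c) = iid (bernoulli_pmf p)"
proof -
  interpret P: prob_space P by fact
  let ?q = "bernoulli_pmf p"
  have p: "0 \<le> p" "p \<le> 1" using prob[of undefined, symmetric] by simp_all
  have m: "(\<lambda>x. x = c) \<in> measurable M (measure_pmf ?q)"
    using A by (simp add: pred_def)
  have X: "X i \<in> measurable P M" for i using indep unfolding P.indep_vars_def by auto
  have Y: "(\<lambda>\<omega>. X i \<omega> = c) \<in> measurable P (measure_pmf ?q)" for i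
    using measurable_compose[OF X m] .
  show meas: "(\<lambda>\<omega> i. X i \<omega> = c) \<in> measurable P (iid ?q)"
    by (rule measurable_into_iid) (use Y in simp)
  have D: "distr P (measure_pmf ?q) (\<lambda>\<omega>. X i \<omega> = c) = measure_pmf ?q" for i
  proof (rule measure_eqI_countable[where A = UNIV])
    fix a :: bool
    have T: "{\<omega> \<in> space P. X i \<omega> = c} \<in> sets P"
      using measurable_sets[OF Y, of "{True}" i] by (simp add: vimage_def Int_def conj_commute)
    have F: "P.prob {\<omega> \<in> space P. X i \<omega> \<noteq> c} = 1 - p"
      using P.prob_neg[of "\<lambda>\<omega>. X i \<omega> = c"] T prob[of i] by simp
    have "emeasure (distr P (measure_pmf ?q) (\<lambda>\<omega>. X i \<omega> = c)) {a} = P.prob {\<omega> \<in> space P. (X i \<omega> = c) = a}"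
      by (subst emeasure_distr[OF Y]) (auto simp: P.emeasure_eq_measure vimage_def Int_def conj_commute)
    also have "\<dots> = pmf ?q a" using prob[of i] F p by (cases a) auto
    finally show "emeasure (distr P (measure_pmf ?q) (\<lambda>\<omega>. X i \<omega> = c)) {a} = emeasure (measure_pmf ?q) {a}"
      by (simp add: emeasure_pmf_single)
  qed auto
  have "P.indep_vars (\<lambda>_. measure_pmf ?q) (\<lambda>i \<omega>. X i \<omega> = c) UNIV"
    by (rule P.indep_vars_compose2[OF indep m])
  then have "distr P (PiM UNIV (\<lambda>_. measure_pmf ?q)) (\<lambda>\<omega>. \<lambda>i\<in>UNIV. X i \<omega> = c)
      = (\<Pi>\<^sub>M i\<in>UNIV. distr P (measure_pmf ?q) (\<lambda>\<omega>. X i \<omega> = c))"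
    by (subst (asm) P.indep_vars_iff_distr_eq_PiM) (use Y in auto)
  then show "distr P (iid ?q) (\<lambda>\<omega> i. X i \<omega> = c) = iid ?q"
    by (simp add: D iid_def restrict_def)
qed

section \<open>Analytic tools\<close>

text \<open>
  The sum of the squares has finite expectation, so it is almost surely finite and its terms tend to 0.
\<close>

lemma AE_tendsto_0_of_summable_second_moments:
  fixes Y :: "nat \<Rightarrow> 'w \<Rightarrow> real"
  assumes int: "\<And>n. integrable M (\<lambda>\<omega>. (Y n \<omega>)\<^sup>2)"
    and sum: "summable b" and le: "\<And>n. (\<integral>\<omega>. (Y n \<omega>)\<^sup>2 \<partial>M) \<le> b n"
  shows "AE \<omega> in M. (\<lambda>n. Y n \<omega>) \<longlonglongrightarrow> 0"
proof -
  have b: "b n \<ge> 0" for n using le[of n] by (rule order_trans[rotated]) simp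
  have [measurable]: "(\<lambda>\<omega>. (Y n \<omega>)\<^sup>2) \<in> borel_measurable M" for n using int[of n] by simp
  have "(\<integral>\<^sup>+\<omega>. (\<Sum>n. ennreal ((Y n \<omega>)\<^sup>2)) \<partial>M) = (\<Sum>n. \<integral>\<^sup>+\<omega>. ennreal ((Y n \<omega>)\<^sup>2) \<partial>M)"
    by (rule nn_integral_suminf) measurable
  also have "\<dots> \<le> (\<Sum>n. ennreal (b n))"
  proof (rule suminf_le)
    show "(\<integral>\<^sup>+\<omega>. ennreal ((Y n \<omega>)\<^sup>2) \<partial>M) \<le> ennreal (b n)" for n
      using le[of n] by (subst nn_integral_eq_integral[OF int]) (auto intro: ennreal_leI)
  qed auto
  also have "\<dots> = ennreal (\<Sum>n. b n)" by (rule suminf_ennreal2[OF b sum])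
  finally have "(\<integral>\<^sup>+\<omega>. (\<Sum>n. ennreal ((Y n \<omega>)\<^sup>2)) \<partial>M) \<noteq> \<infinity>"
    by (auto simp: top_unique)
  then have "AE \<omega> in M. (\<Sum>n. ennreal ((Y n \<omega>)\<^sup>2)) \<noteq> \<infinity>"
    by (intro nn_integral_PInf_AE) measurable
  then show ?thesis
  proof eventually_elim
    case (elim \<omega>)
    then have "summable (\<lambda>n. (Y n \<omega>)\<^sup>2)"
      by (intro summable_suminf_not_top) (auto simp: infinity_ennreal_def)
    then have "(\<lambda>n. (Y n \<omega>)\<^sup>2) \<longlonglongrightarrow> 0" by (rule summable_LIMSEQ_zero)
    then show ?case by (simp add: tendsto_null_power)
  qed
qed

text \<open>
  Jensen's inequality for the logarithm and the probability weights \<open>w s / sum w S\<close>, obtained by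
  averaging \<open>ln z \<le> z - 1\<close> at the ratios of \<open>y s\<close> to its mean.
\<close>

lemma ln_sum_ge_weighted_sum_ln:
  fixes w y :: "'a \<Rightarrow> real"
  assumes "finite S" "S \<noteq> {}" "\<And>s. s \<in> S \<Longrightarrow> w s > 0" "\<And>s. s \<in> S \<Longrightarrow> y s > 0"
  shows "ln (\<Sum>s\<in>S. w s) + (\<Sum>s\<in>S. w s / (\<Sum>s\<in>S. w s) * ln (y s)) \<le> ln (\<Sum>s\<in>S. w s * y s)"
proof -
  define V where "V = (\<Sum>s\<in>S. w s)"
  define U where "U = (\<Sum>s\<in>S. w s * y s)"
  have V: "V > 0" unfolding V_def using assms by (intro sum_pos) auto
  have U: "U > 0" unfolding U_def using assms by (intro sum_pos) auto
  have one: "(\<Sum>s\<in>S. w s / V) = 1" using V by (simp add: sum_divide_distrib[symmetric] V_def[symmetric])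
  have "(\<Sum>s\<in>S. w s / V * ln (y s)) - (ln U - ln V) = (\<Sum>s\<in>S. w s / V * ln (y s)) - (\<Sum>s\<in>S. w s / V) * (ln U - ln V)"
    by (simp add: one)
  also have "\<dots> = (\<Sum>s\<in>S. w s / V * (ln (y s) - (ln U - ln V)))"
    by (simp add: sum_distrib_right right_diff_distrib sum_subtractf)
  also have "\<dots> \<le> (\<Sum>s\<in>S. w s / V * (y s * V / U - 1))"
  proof (intro sum_mono mult_left_mono)
    fix s assume s: "s \<in> S"
    have "ln (y s) - (ln U - ln V) = ln (y s * V / U)"
      using assms(4)[OF s] U V by (simp add: ln_mult ln_div)
    also have "\<dots> \<le> y s * V / U - 1"
      using assms(4)[OF s] U V by (intro ln_le_minus_one) simp
    finally show "ln (y s) - (ln U - ln V) \<le> y s * V / U - 1" .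
    show "0 \<le> w s / V" using assms(3)[OF s] V by simp
  qed
  also have "\<dots> = (\<Sum>s\<in>S. w s * y s / U - w s / V)"
    using V by (intro sum.cong refl) (simp add: field_simps)
  also have "\<dots> = 0"
    using U by (simp add: sum_subtractf one) (simp add: sum_divide_distrib[symmetric] U_def[symmetric])
  finally show ?thesis by (simp add: V_def U_def)
qed

text \<open>
  Fekete's lemma: the limit is the supremum \<open>L\<close> of the ratios. A nearly optimal \<open>m\<close> is used by
  dividing \<open>n\<close> by \<open>m\<close> with remainder, which costs only a bounded amount.
\<close>

lemma superadditive_convergent:
  fixes a :: "nat \<Rightarrow> real"
  assumes super: "\<And>m n. a m + a n \<le> a (m + n)" and upper: "\<And>n. a n \<le> C * real n"
  shows "convergent (\<lambda>n. a n / real n)"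
proof -
  define L where "L = (SUP n\<in>{1..}. a n / real n)"
  have bdd: "bdd_above ((\<lambda>n. a n / real n) ` {1..})"
    using upper by (intro bdd_aboveI[of _ C]) (auto simp: divide_le_eq mult.commute)
  have le_L: "a n / real n \<le> L" if "n \<ge> 1" for n
    unfolding L_def by (rule cSUP_upper[OF _ bdd]) (use that in simp)
  have mult: "real k * a m + a r \<le> a (k * m + r)" for k m r
  proof (induction k)
    case (Suc k)
    have "a m + (real k * a m + a r) \<le> a m + a (k * m + r)" using Suc by simp
    also have "\<dots> \<le> a (Suc k * m + r)" using super[of m "k * m + r"] by (simp add: add.assoc)
    finally show ?case by (simp add: algebra_simps)
  qed simp
  have "(\<lambda>n. a n / real n) \<longlonglongrightarrow> L"
  proof (rule LIMSEQ_I)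
    fix \<epsilon> :: real assume \<epsilon>: "\<epsilon> > 0"
    have "\<exists>m\<in>{1..}. L - \<epsilon> / 2 < a m / real m"
      unfolding L_def using bdd \<epsilon> by (subst less_cSUP_iff[symmetric]) (auto simp: L_def)
    then obtain m :: nat where m: "m \<ge> 1" "L - \<epsilon> / 2 < a m / real m" by auto
    define B where "B = (\<Sum>r<m. \<bar>a r\<bar>)"
    define D where "D = \<bar>a m\<bar> + B"
    have B: "\<bar>a r\<bar> \<le> B" if "r < m" for r
      unfolding B_def by (rule member_le_sum[of r "{..<m}" "\<lambda>r. \<bar>a r\<bar>"]) (use that in auto)
    have D: "D \<ge> 0" unfolding D_def B_def by (simp add: sum_nonneg)
    have low: "a m / real m - D / real n \<le> a n / real n" if n: "n \<ge> 1" for n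
    proof -
      define k r where "k = n div m" and "r = n mod m"
      have kr: "n = k * m + r" "r < m" using m by (auto simp: k_def r_def)
      have "real n * (a m / real m) = real k * a m + real r / real m * a m"
        using m by (subst kr(1)) (simp add: field_simps)
      also have "real r / real m * a m \<le> 1 * \<bar>a m\<bar>"
        using kr m by (intro order_trans[OF mult_left_mono[OF abs_ge_self] mult_right_mono]) auto
      finally have "real n * (a m / real m) - D \<le> real k * a m + a r"
        using B[OF kr(2)] by (simp add: D_def abs_le_iff)
      also have "\<dots> \<le> a n" using mult[of k m r] kr(1) by simp
      finally have "(real n * (a m / real m) - D) / real n \<le> a n / real n"
        by (rule divide_right_mono) simp
      then show ?thesis using n by (simp add: diff_divide_distrib)
    qed
    obtain N :: nat where N: "D / (\<epsilon> / 2) < real N" using reals_Archimedean2 by blast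
    show "\<exists>no. \<forall>n\<ge>no. norm (a n / real n - L) < \<epsilon>"
    proof (intro exI allI impI)
      fix n assume n: "max N 1 \<le> n"
      then have "D / (\<epsilon> / 2) < real n" using N by linarith
      then have "D / real n < \<epsilon> / 2" using \<epsilon> n by (simp add: field_simps)
      then show "norm (a n / real n - L) < \<epsilon>"
        using low[of n] le_L[of n] n m(2) \<epsilon> by (simp add: abs_if)
    qed
  qed
  then show ?thesis by (rule convergentI)
qed

lemma filterlim_floor_sqrt: "filterlim floor_sqrt at_top sequentially"
  unfolding filterlim_at_top eventually_sequentially
  by (metis le_floor_sqrt_iff)

text \<open>
  A lower bound on increments suffices for an interpolation on both sides: \<open>x n\<close> is compared from
  below with the preceding square and from above with the following one, at distance \<open>O(sqrt n)\<close>.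
\<close>

lemma tendsto_of_tendsto_along_squares:
  fixes x :: "nat \<Rightarrow> real"
  assumes incr: "\<And>m n. x m - C * real n \<le> x (m + n)"
    and sq: "(\<lambda>n. x (n\<^sup>2) / real (n\<^sup>2)) \<longlonglongrightarrow> l"
  shows "(\<lambda>n. x n / real n) \<longlonglongrightarrow> l"
proof -
  \<comment> \<open>Subtracting the limit line reduces the claim to the limit 0.\<close>
  define D where "D = \<bar>C\<bar> + \<bar>l\<bar>"
  define y where "y n = x n - l * real n" for n
  have D: "D \<ge> 0" by (simp add: D_def)
  have y: "y m - D * real n \<le> y (m + n)" for m n
  proof -
    have "(C + l) * real n \<le> D * real n" unfolding D_def by (intro mult_right_mono) auto
    then show ?thesis using incr[of m n] by (simp add: y_def algebra_simps)
  qed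
  (* For k = floor_sqrt n this bounds |y n| / n. The factor 4 comes from (k + 1)^2 <= 4 n, and the
     distance from n to either square is at most 3 k. *)
  define e where "e k = 4 * \<bar>y ((k + 1)\<^sup>2) / real ((k + 1)\<^sup>2)\<bar> + \<bar>y (k\<^sup>2) / real (k\<^sup>2)\<bar> + 3 * D / real k" for k
  have ysq: "(\<lambda>k. \<bar>y (k\<^sup>2) / real (k\<^sup>2)\<bar>) \<longlonglongrightarrow> 0"
  proof -
    have "(\<lambda>k. x (k\<^sup>2) / real (k\<^sup>2) - l) \<longlonglongrightarrow> l - l" by (intro tendsto_intros sq)
    moreover have "\<forall>\<^sub>F k in sequentially. x (k\<^sup>2) / real (k\<^sup>2) - l = y (k\<^sup>2) / real (k\<^sup>2)"
      using eventually_gt_at_top[of 0] by eventually_elim (simp add: y_def field_simps)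
    ultimately have "(\<lambda>k. y (k\<^sup>2) / real (k\<^sup>2)) \<longlonglongrightarrow> 0" by (simp add: tendsto_cong)
    then show ?thesis by (rule tendsto_rabs_zero)
  qed
  have "(\<lambda>k. 3 * D / real k) \<longlonglongrightarrow> 0" by (rule lim_const_over_n)
  from tendsto_add[OF tendsto_add[OF tendsto_mult[OF tendsto_const[of 4] LIMSEQ_ignore_initial_segment[OF ysq, of 1]] ysq] this]
  have "e \<longlonglongrightarrow> 0" by (simp add: e_def[abs_def])
  then have lim: "(\<lambda>n. e (floor_sqrt n)) \<longlonglongrightarrow> 0" by (rule filterlim_compose[OF _ filterlim_floor_sqrt])
  have "(\<lambda>n. y n / real n) \<longlonglongrightarrow> 0"
  proof (rule Lim_null_comparison[OF _ lim])
    show "\<forall>\<^sub>F n in sequentially. norm (y n / real n) \<le> e (floor_sqrt n)"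
      using eventually_ge_at_top[of 1]
    proof eventually_elim
      case (elim n)
      define k where "k = floor_sqrt n"
      have k: "k \<ge> 1" "k\<^sup>2 \<le> n" "n < (k + 1)\<^sup>2"
        using elim Suc_floor_sqrt_power2_gt[of n] by (auto simp: k_def Suc_le_eq)
      have sq1: "real ((k + 1)\<^sup>2) = (real k)\<^sup>2 + 2 * real k + 1" by (simp add: power2_eq_square algebra_simps)
      have kk: "real k \<le> (real k)\<^sup>2" using k(1) by (simp add: power2_eq_square)
      have kn: "(real k)\<^sup>2 \<le> real n" using k(2) by (metis of_nat_le_iff of_nat_power)
      have nk: "real n < (real k)\<^sup>2 + 2 * real k + 1" using k(3) sq1 by (metis of_nat_less_iff)
      have n0: "real n > 0" using elim by simp
      have up: "y n \<le> y ((k + 1)\<^sup>2) + D * (3 * real k)"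
      proof -
        have "D * real ((k + 1)\<^sup>2 - n) \<le> D * (3 * real k)"
        proof (rule mult_left_mono[OF _ D])
          have "real ((k + 1)\<^sup>2 - n) = real ((k + 1)\<^sup>2) - real n"
            by (rule of_nat_diff) (use k(3) in simp)
          also have "\<dots> \<le> 3 * real k" unfolding sq1 using kn k(1) by linarith
          finally show "real ((k + 1)\<^sup>2 - n) \<le> 3 * real k" .
        qed
        then show ?thesis using y[of n "(k + 1)\<^sup>2 - n"] k(3) by simp
      qed
      have low: "y (k\<^sup>2) - D * (3 * real k) \<le> y n"
      proof -
        have "D * real (n - k\<^sup>2) \<le> D * (3 * real k)"
          using k nk by (intro mult_left_mono D) (auto simp: of_nat_diff)
        then show ?thesis using y[of "k\<^sup>2" "n - k\<^sup>2"] k(2) by simp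
      qed
      have t: "D * (3 * real k) / real n \<le> 3 * D / real k"
      proof -
        have "D * (3 * real k) / real n \<le> D * (3 * real k) / (real k)\<^sup>2"
          using kn k(1) D n0 by (intro divide_left_mono mult_pos_pos) auto
        then show ?thesis using k(1) by (simp add: power2_eq_square mult.commute)
      qed
      have a1: "\<bar>y ((k + 1)\<^sup>2)\<bar> / real n \<le> 4 * \<bar>y ((k + 1)\<^sup>2) / real ((k + 1)\<^sup>2)\<bar>"
      proof -
        have "real ((k + 1)\<^sup>2) \<le> 4 * real n" unfolding sq1 using kk kn k(1) by linarith
        then have "\<bar>y ((k + 1)\<^sup>2)\<bar> * real ((k + 1)\<^sup>2) \<le> \<bar>y ((k + 1)\<^sup>2)\<bar> * (4 * real n)" by (intro mult_left_mono) auto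
        then show ?thesis using n0 by (simp add: abs_divide field_simps del: of_nat_power)
      qed
      have a2: "\<bar>y (k\<^sup>2)\<bar> / real n \<le> \<bar>y (k\<^sup>2) / real (k\<^sup>2)\<bar>"
      proof -
        have "\<bar>y (k\<^sup>2)\<bar> / real n \<le> \<bar>y (k\<^sup>2)\<bar> / (real k)\<^sup>2"
          using kn k(1) n0 by (intro divide_left_mono mult_pos_pos) auto
        then show ?thesis by (simp add: abs_divide)
      qed
      have "y n / real n \<le> (y ((k + 1)\<^sup>2) + D * (3 * real k)) / real n"
        using up n0 by (intro divide_right_mono) auto
      also have "\<dots> \<le> \<bar>y ((k + 1)\<^sup>2)\<bar> / real n + D * (3 * real k) / real n"
        unfolding add_divide_distrib[symmetric] using n0 by (intro divide_right_mono) auto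
      also have "\<dots> \<le> e k" unfolding e_def using t a1 abs_ge_zero[of "y (k\<^sup>2) / real (k\<^sup>2)"] by linarith
      finally have 1: "y n / real n \<le> e k" .
      have "- (y n / real n) \<le> (- y (k\<^sup>2) + D * (3 * real k)) / real n"
        unfolding minus_divide_left using low n0 by (intro divide_right_mono) auto
      also have "\<dots> \<le> \<bar>y (k\<^sup>2)\<bar> / real n + D * (3 * real k) / real n"
        unfolding add_divide_distrib[symmetric] using n0 by (intro divide_right_mono) auto
      also have "\<dots> \<le> e k" unfolding e_def using t a2 abs_ge_zero[of "y ((k + 1)\<^sup>2) / real ((k + 1)\<^sup>2)"] by linarith
      finally show ?case using 1 by (simp add: k_def[symmetric] abs_le_iff)
    qed
  qed
  then have "(\<lambda>n. y n / real n + l) \<longlonglongrightarrow> 0 + l" by (intro tendsto_intros)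
  moreover have "\<forall>\<^sub>F n in sequentially. y n / real n + l = x n / real n"
    using eventually_gt_at_top[of 0] by eventually_elim (simp add: y_def field_simps)
  ultimately show ?thesis by (simp add: tendsto_cong)
qed

section \<open>Counting walks with a softened constraint\<close>

text \<open>
  A walk is the list of its steps, so that concatenation of walks is append and a translation acts
  on the starting point only. As for \<open>W\<close>, the starting point itself is not counted.
\<close>

primrec hits :: "('v::monoid_add \<Rightarrow> bool) \<Rightarrow> 'v \<Rightarrow> 'v list \<Rightarrow> nat" where
  "hits \<eta> v [] = 0"
| "hits \<eta> v (e # us) = of_bool (\<eta> (v + e)) + hits \<eta> (v + e) us"

lemma hits_append: "hits \<eta> v (us @ vs) = hits \<eta> v us + hits \<eta> (v + sum_list us) vs"
  by (induction us arbitrary: v) (simp_all add: add.assoc)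

lemma hits_le_length: "hits \<eta> v us \<le> length us"
proof (induction us arbitrary: v)
  case (Cons e us)
  from Cons.IH[of "v + e"] show ?case by simp
qed simp

lemma hits_translate: "hits \<eta> (v + z) us = hits (\<lambda>u. \<eta> (v + u)) z us"
  by (induction us arbitrary: z) (simp_all add: add.assoc)

lemma measurable_hits [measurable]:
  "(\<lambda>\<eta>. real (hits \<eta> v us)) \<in> borel_measurable (iid q)"
proof (induction us arbitrary: v)
  case (Cons e us)
  have "(\<lambda>\<eta>. of_bool (\<eta> (v + e)) :: real) \<in> borel_measurable (iid q)"
    by (rule measurable_compose[OF measurable_iid_coordinate]) simp
  then show ?case using Cons.IH[of "v + e"] by simp
qed simp

text \<open>
  Every step raises the last coordinate by one, so a walk visits each level at most once, and the
  parts of a concatenated walk see disjoint sets of vertices.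
\<close>

locale oriented_walks =
  fixes E :: "('a::cancel_comm_monoid_add \<times> nat) set"
  assumes finite_E: "finite E" and E_nonempty: "E \<noteq> {}"
    and snd_E: "\<And>e. e \<in> E \<Longrightarrow> snd e = 1"
begin

definition walks :: "nat \<Rightarrow> ('a \<times> nat) list set" where
  "walks n = {us. set us \<subseteq> E \<and> length us = n}"

text \<open>
  The penalty is \<open>K\<close> per hit that is missing to reach the threshold \<open>A\<close>. The limit \<open>K \<rightarrow> \<infinity>\<close> is the
  indicator of at least \<open>A\<close> hits.
\<close>

definition weight :: "real \<Rightarrow> real \<Rightarrow> 'a \<times> nat \<Rightarrow> ('a \<times> nat) list \<Rightarrow> ('a \<times> nat \<Rightarrow> bool) \<Rightarrow> real" where
  "weight K A v us \<eta> = exp (- K * max 0 (A - real (hits \<eta> v us)))"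

definition soft_count :: "real \<Rightarrow> real \<Rightarrow> nat \<Rightarrow> 'a \<times> nat \<Rightarrow> ('a \<times> nat \<Rightarrow> bool) \<Rightarrow> real" where
  "soft_count K A n v \<eta> = (\<Sum>us\<in>walks n. weight K A v us \<eta>)"

definition log_count :: "real \<Rightarrow> real \<Rightarrow> nat \<Rightarrow> 'a \<times> nat \<Rightarrow> ('a \<times> nat \<Rightarrow> bool) \<Rightarrow> real" where
  "log_count K A n v \<eta> = ln (soft_count K A n v \<eta>)"

lemma finite_walks: "finite (walks n)"
  unfolding walks_def by (rule finite_lists_length_eq[OF finite_E])

lemma card_walks: "card (walks n) = card E ^ n"
  unfolding walks_def by (rule card_lists_length_eq[OF finite_E])

lemma card_E_ge_1: "card E \<ge> 1"
  using finite_E E_nonempty by (simp add: Suc_le_eq card_gt_0_iff)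

lemma walks_nonempty: "walks n \<noteq> {}"
  using card_walks[of n] card_E_ge_1 by fastforce

lemma walks_0: "walks 0 = {[]}"
  by (auto simp: walks_def)

lemma walks_add: "walks (m + n) = (\<lambda>(us, vs). us @ vs) ` (walks m \<times> walks n)"
proof (intro equalityI subsetI)
  fix us assume "us \<in> walks (m + n)"
  then have "us = take m us @ drop m us" "take m us \<in> walks m" "drop m us \<in> walks n"
    by (auto simp: walks_def dest: in_set_takeD in_set_dropD)
  then show "us \<in> (\<lambda>(us, vs). us @ vs) ` (walks m \<times> walks n)"
    by (metis (no_types, lifting) case_prod_conv image_eqI mem_Sigma_iff)
qed (auto simp: walks_def)

lemma snd_sum_list_walk: "us \<in> walks n \<Longrightarrow> snd (sum_list us) = n"
proof (induction us arbitrary: n)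
  case (Cons e us)
  then have "us \<in> walks (n - 1)" "snd e = 1" "n \<ge> 1" using snd_E by (auto simp: walks_def)
  then show ?case using Cons.IH[of "n - 1"] by simp
qed (simp add: walks_def)

lemma hits_cong_levels:
  assumes "set us \<subseteq> E" "\<And>u. snd v < snd u \<Longrightarrow> snd u \<le> snd v + length us \<Longrightarrow> \<eta> u = \<eta>' u"
  shows "hits \<eta> v us = hits \<eta>' v us"
  using assms
proof (induction us arbitrary: v)
  case (Cons e us)
  have e: "snd e = 1" using Cons.prems(1) snd_E[of e] by simp
  have "hits \<eta> (v + e) us = hits \<eta>' (v + e) us"
    by (rule Cons.IH) (use Cons.prems e in auto)
  moreover have "\<eta> (v + e) = \<eta>' (v + e)" by (rule Cons.prems(2)) (use e in auto)
  ultimately show ?case by simp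
qed simp

lemma hits_change_one_level:
  assumes "set us \<subseteq> E" "\<And>u. snd u \<noteq> k \<Longrightarrow> \<eta> u = \<eta>' u"
  shows "hits \<eta> v us \<le> hits \<eta>' v us + of_bool (snd v < k)"
  using assms(1)
proof (induction us arbitrary: v)
  case (Cons e us)
  have e: "snd e = 1" using Cons.prems snd_E[of e] by simp
  have IH: "hits \<eta> (v + e) us \<le> hits \<eta>' (v + e) us + of_bool (Suc (snd v) < k)"
    using Cons.IH[of "v + e"] Cons.prems e by simp
  show ?case
  proof (cases "Suc (snd v) = k")
    case True
    then show ?thesis using IH by simp
  next
    case False
    then have "\<eta> (v + e) = \<eta>' (v + e)" by (intro assms(2)) (simp add: e)
    then show ?thesis using IH by (cases "Suc (snd v) < k") auto
  qed
qed simp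

lemma weight_pos: "weight K A v us \<eta> > 0"
  by (simp add: weight_def)

lemma weight_le_1: "K \<ge> 0 \<Longrightarrow> weight K A v us \<eta> \<le> 1"
  by (simp add: weight_def)

lemma weight_ge: "K \<ge> 0 \<Longrightarrow> exp (- K * max 0 A) \<le> weight K A v us \<eta>"
  unfolding weight_def exp_le_cancel_iff by (simp add: mult_left_mono)

text \<open>
  Subadditivity of the positive part: surplus hits of one part may offset missing hits of the other, so
  the joint penalty is at most the sum of the separate ones.
\<close>

lemma weight_append:
  assumes "K \<ge> 0"
  shows "weight K A v us \<eta> * weight K B (v + sum_list us) vs \<eta> \<le> weight K (A + B) v (us @ vs) \<eta>"
proof -
  let ?a = "A - real (hits \<eta> v us)" and ?b = "B - real (hits \<eta> (v + sum_list us) vs)"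
  have "K * max 0 (?a + ?b) \<le> K * (max 0 ?a + max 0 ?b)"
    by (rule mult_left_mono[OF _ assms]) linarith
  moreover have "A + B - real (hits \<eta> v (us @ vs)) = ?a + ?b" by (simp add: hits_append)
  ultimately show ?thesis
    unfolding weight_def exp_add[symmetric] exp_le_cancel_iff by (simp add: algebra_simps)
qed

lemma soft_count_pos: "soft_count K A n v \<eta> > 0"
  unfolding soft_count_def using walks_nonempty weight_pos finite_walks by (intro sum_pos) auto

lemma weight_le_soft_count: "us \<in> walks n \<Longrightarrow> weight K A v us \<eta> \<le> soft_count K A n v \<eta>"
  unfolding soft_count_def by (rule member_le_sum[OF _ less_imp_le[OF weight_pos] finite_walks])

lemma soft_count_le: "K \<ge> 0 \<Longrightarrow> soft_count K A n v \<eta> \<le> real (card E) ^ n"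
  using sum_bounded_above[of "walks n" "\<lambda>us. weight K A v us \<eta>" 1] weight_le_1
  by (simp add: soft_count_def card_walks)

lemma soft_count_ge: "K \<ge> 0 \<Longrightarrow> exp (- K * max 0 A) \<le> soft_count K A n v \<eta>"
proof -
  assume K: "K \<ge> 0"
  have "1 * exp (- K * max 0 A) \<le> real (card (walks n)) * exp (- K * max 0 A)"
    using card_E_ge_1 unfolding card_walks by (intro mult_right_mono) (auto simp: of_nat_power)
  also have "\<dots> \<le> soft_count K A n v \<eta>"
    unfolding soft_count_def by (rule sum_bounded_below) (rule weight_ge[OF K])
  finally show ?thesis by simp
qed

lemma log_count_le:
  assumes "K \<ge> 0" shows "log_count K A n v \<eta> \<le> real n * ln (real (card E))"
proof -
  have "log_count K A n v \<eta> \<le> ln (real (card E) ^ n)"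
    unfolding log_count_def using soft_count_le[OF assms] soft_count_pos by (intro ln_mono) auto
  then show ?thesis using card_E_ge_1 by (simp add: ln_realpow)
qed

lemma log_count_ge: "K \<ge> 0 \<Longrightarrow> - K * max 0 A \<le> log_count K A n v \<eta>"
  unfolding log_count_def using soft_count_ge soft_count_pos by (subst ln_ge_iff) auto

lemma abs_log_count_le:
  assumes "K \<ge> 0"
  shows "\<bar>log_count K A n v \<eta>\<bar> \<le> real n * ln (real (card E)) + K * max 0 A"
proof -
  have "0 \<le> real n * ln (real (card E))" "0 \<le> K * max 0 A" using card_E_ge_1 assms by auto
  then show ?thesis using log_count_le[OF assms, of A n v \<eta>] log_count_ge[OF assms, of A n v \<eta>] by linarith
qed

lemma soft_count_add_ge:
  assumes "K \<ge> 0"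
  shows "(\<Sum>us\<in>walks m. weight K A v us \<eta> * soft_count K B n (v + sum_list us) \<eta>) \<le> soft_count K (A + B) (m + n) v \<eta>"
proof -
  have inj: "inj_on (\<lambda>(us, vs). us @ vs) (walks m \<times> walks n)"
    by (auto simp: inj_on_def walks_def)
  have "(\<Sum>us\<in>walks m. weight K A v us \<eta> * soft_count K B n (v + sum_list us) \<eta>)
    = (\<Sum>(us, vs)\<in>walks m \<times> walks n. weight K A v us \<eta> * weight K B (v + sum_list us) vs \<eta>)"
    unfolding soft_count_def sum_distrib_left by (simp add: sum.cartesian_product)
  also have "\<dots> \<le> (\<Sum>(us, vs)\<in>walks m \<times> walks n. weight K (A + B) v (us @ vs) \<eta>)"
    by (intro sum_mono) (auto intro: weight_append[OF assms])
  also have "\<dots> = soft_count K (A + B) (m + n) v \<eta>"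
    unfolding soft_count_def walks_add sum.reindex[OF inj] by (simp add: case_prod_beta)
  finally show ?thesis .
qed

text \<open>
  The first \<open>m\<close> steps are drawn with probability proportional to their weight. This form, linear in
  the logarithms of the second parts, allows expectations to be taken.
\<close>

lemma log_count_add_ge:
  assumes "K \<ge> 0"
  shows "log_count K A m v \<eta> + (\<Sum>us\<in>walks m. weight K A v us \<eta> / soft_count K A m v \<eta> * log_count K B n (v + sum_list us) \<eta>)
    \<le> log_count K (A + B) (m + n) v \<eta>"
proof -
  have "log_count K A m v \<eta> + (\<Sum>us\<in>walks m. weight K A v us \<eta> / soft_count K A m v \<eta> * log_count K B n (v + sum_list us) \<eta>)
    \<le> ln (\<Sum>us\<in>walks m. weight K A v us \<eta> * soft_count K B n (v + sum_list us) \<eta>)"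
    unfolding log_count_def soft_count_def[of K A m]
    by (rule ln_sum_ge_weighted_sum_ln[OF finite_walks walks_nonempty weight_pos soft_count_pos])
  also have "\<dots> \<le> log_count K (A + B) (m + n) v \<eta>"
    unfolding log_count_def
    by (intro ln_mono soft_count_add_ge[OF assms] sum_pos finite_walks walks_nonempty mult_pos_pos weight_pos soft_count_pos)
  finally show ?thesis .
qed

lemma sum_walk_probabilities: "(\<Sum>us\<in>walks m. weight K A v us \<eta> / soft_count K A m v \<eta>) = 1"
  using soft_count_pos[of K A m v \<eta>]
  by (simp add: sum_divide_distrib[symmetric] soft_count_def[symmetric])

text \<open>
  The deterministic bound on increments used to pass from square times to all times.
\<close>

lemma log_count_add_ge_crude:
  assumes "K \<ge> 0"
  shows "log_count K A m v \<eta> - K * max 0 B \<le> log_count K (A + B) (m + n) v \<eta>"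
proof -
  have "- K * max 0 B = (\<Sum>us\<in>walks m. weight K A v us \<eta> / soft_count K A m v \<eta>) * (- K * max 0 B)"
    by (simp add: sum_walk_probabilities)
  also have "\<dots> \<le> (\<Sum>us\<in>walks m. weight K A v us \<eta> / soft_count K A m v \<eta> * log_count K B n (v + sum_list us) \<eta>)"
    unfolding sum_distrib_right
    by (intro sum_mono mult_left_mono log_count_ge[OF assms]) (auto intro!: divide_nonneg_pos soft_count_pos less_imp_le[OF weight_pos])
  finally show ?thesis using log_count_add_ge[OF assms, of A m v \<eta> B n] by simp
qed

text \<open>
  A walk meets level \<open>k\<close> at most once, so its hits change by at most 1 and its weight by a factor of
  at most \<open>exp K\<close>.
\<close>

lemma log_count_change_one_level:
  assumes "K \<ge> 0" "\<And>u. snd u \<noteq> k \<Longrightarrow> \<eta> u = \<eta>' u"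
  shows "\<bar>log_count K A n v \<eta> - log_count K A n v \<eta>'\<bar> \<le> K"
proof -
  have le: "log_count K A n v \<eta> \<le> K + log_count K A n v \<eta>'" if "\<And>u. snd u \<noteq> k \<Longrightarrow> \<eta> u = \<eta>' u" for \<eta> \<eta>'
  proof -
    have "soft_count K A n v \<eta> \<le> (\<Sum>us\<in>walks n. exp K * weight K A v us \<eta>')"
      unfolding soft_count_def
    proof (rule sum_mono)
      fix us assume "us \<in> walks n"
      then have "hits \<eta> v us \<le> hits \<eta>' v us + of_bool (snd v < k)"
        by (intro hits_change_one_level that) (auto simp: walks_def)
      also have "\<dots> \<le> hits \<eta>' v us + 1" by simp
      finally have "max 0 (A - real (hits \<eta>' v us)) \<le> 1 + max 0 (A - real (hits \<eta> v us))" by linarith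
      from mult_left_mono[OF this assms(1)]
      show "weight K A v us \<eta> \<le> exp K * weight K A v us \<eta>'"
        unfolding weight_def exp_add[symmetric] exp_le_cancel_iff by (simp add: algebra_simps)
    qed
    also have "\<dots> = exp K * soft_count K A n v \<eta>'" by (simp add: soft_count_def sum_distrib_left)
    finally have "log_count K A n v \<eta> \<le> ln (exp K * soft_count K A n v \<eta>')"
      unfolding log_count_def by (rule ln_mono[OF _ soft_count_pos])
    then show ?thesis
      using soft_count_pos[of K A n v \<eta>'] by (simp add: ln_mult log_count_def)
  qed
  show ?thesis using le[of \<eta> \<eta>'] le[of \<eta>' \<eta>] assms(2) by fastforce
qed

lemma weight_depends:
  "us \<in> walks n \<Longrightarrow> depends_only_on (weight K A v us) {u. snd v < snd u \<and> snd u \<le> snd v + n}"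
  unfolding depends_only_on_def weight_def
proof (intro allI impI)
  fix \<omega> \<omega>' :: "'a \<times> nat \<Rightarrow> bool"
  assume us: "us \<in> walks n" and *: "\<forall>i\<in>{u. snd v < snd u \<and> snd u \<le> snd v + n}. \<omega> i = \<omega>' i"
  have "hits \<omega> v us = hits \<omega>' v us" by (rule hits_cong_levels) (use us * in \<open>auto simp: walks_def\<close>)
  then show "exp (- K * max 0 (A - real (hits \<omega> v us))) = exp (- K * max 0 (A - real (hits \<omega>' v us)))" by simp
qed

lemma soft_count_depends: "depends_only_on (soft_count K A n v) {u. snd v < snd u \<and> snd u \<le> snd v + n}"
  using weight_depends unfolding depends_only_on_def soft_count_def by (intro allI impI sum.cong refl) blast

lemma log_count_depends: "depends_only_on (log_count K A n v) {u. snd v < snd u \<and> snd u \<le> snd v + n}"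
  using soft_count_depends unfolding depends_only_on_def log_count_def by metis

lemma log_count_translate: "log_count K A n v \<eta> = log_count K A n 0 (\<lambda>u. \<eta> (v + u))"
  unfolding log_count_def soft_count_def weight_def using hits_translate[of \<eta> v 0] by simp

lemma measurable_weight [measurable]: "weight K A v us \<in> borel_measurable (iid q)"
  unfolding weight_def[abs_def] by measurable

lemma measurable_soft_count [measurable]: "soft_count K A n v \<in> borel_measurable (iid q)"
  unfolding soft_count_def[abs_def] by measurable

lemma measurable_log_count [measurable]: "log_count K A n v \<in> borel_measurable (iid q)"
  unfolding log_count_def[abs_def] by measurable

lemma integrable_log_count: "K \<ge> 0 \<Longrightarrow> integrable (iid q) (log_count K A n v)"
  by (rule integrable_iid_bounded[OF measurable_log_count abs_log_count_le])

definition mean_log_count :: "bool pmf \<Rightarrow> real \<Rightarrow> real \<Rightarrow> nat \<Rightarrow> real" where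
  "mean_log_count q K A n = (\<integral>\<eta>. log_count K A n 0 \<eta> \<partial>iid q)"

lemma integral_log_count: "(\<integral>\<eta>. log_count K A n v \<eta> \<partial>iid q) = mean_log_count q K A n"
proof -
  have "inj (\<lambda>u. v + u)" by (auto simp: inj_def)
  from integral_iid_reindex[OF this measurable_log_count[of K A n 0 q]]
  show ?thesis unfolding mean_log_count_def log_count_translate[of K A n v] .
qed

text \<open>
  The path probabilities of the first part depend on the levels up to \<open>m\<close> and the soft counts of the
  second part on the levels above \<open>m\<close>. By independence and translation invariance each second part
  contributes the same mean, and the probabilities add up to 1.
\<close>

lemma mean_log_count_add_ge:
  assumes K: "K \<ge> 0"
  shows "mean_log_count q K A m + mean_log_count q K B n \<le> mean_log_count q K (A + B) (m + n)"
proof -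
  interpret prob_space "iid q :: ('a \<times> nat \<Rightarrow> bool) measure" by (rule prob_space_iid)
  let ?r = "\<lambda>us \<eta>. weight K A 0 us \<eta> / soft_count K A m 0 \<eta>"
  let ?l = "\<lambda>us. log_count K B n (0 + sum_list us)"
  let ?B = "real n * ln (real (card E)) + K * max 0 B"
  have rm: "?r us \<in> borel_measurable (iid q)" for us by measurable
  have r01: "\<bar>?r us \<eta>\<bar> \<le> 1" if "us \<in> walks m" for us \<eta>
  proof -
    show ?thesis
      using soft_count_pos[of K A m 0 \<eta>] weight_pos[of K A 0 us \<eta>] weight_le_soft_count[OF that, of K A 0 \<eta>] by simp
  qed
  have rI: "integrable (iid q) (?r us)" if "us \<in> walks m" for us
    by (rule integrable_iid_bounded[OF rm r01[OF that]])
  have rlb: "\<bar>?r us \<eta> * ?l us \<eta>\<bar> \<le> 1 * ?B" if "us \<in> walks m" for us \<eta>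
    unfolding abs_mult by (rule mult_mono[OF r01[OF that] abs_log_count_le[OF K]]) auto
  have rlI: "integrable (iid q) (\<lambda>\<eta>. ?r us \<eta> * ?l us \<eta>)" if "us \<in> walks m" for us
    by (rule integrable_iid_bounded[OF _ rlb[OF that]]) (intro borel_measurable_times rm measurable_log_count)
  have indep: "(\<integral>\<eta>. ?r us \<eta> * ?l us \<eta> \<partial>iid q) = (\<integral>\<eta>. ?r us \<eta> \<partial>iid q) * mean_log_count q K B n"
    if us: "us \<in> walks m" for us
  proof -
    have "depends_only_on (?r us) {u. snd u \<le> m}"
      unfolding depends_only_on_def
    proof (intro allI impI)
      fix \<omega> \<omega>' :: "'a \<times> nat \<Rightarrow> bool" assume "\<forall>i\<in>{u. snd u \<le> m}. \<omega> i = \<omega>' i"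
      then have *: "\<forall>i\<in>{u. snd (0 :: 'a \<times> nat) < snd u \<and> snd u \<le> snd (0 :: 'a \<times> nat) + m}. \<omega> i = \<omega>' i" by simp
      have "weight K A 0 us \<omega> = weight K A 0 us \<omega>'"
        using weight_depends[OF us, of K A 0] * unfolding depends_only_on_def by blast
      moreover have "soft_count K A m 0 \<omega> = soft_count K A m 0 \<omega>'"
        using soft_count_depends[of K A m 0] * unfolding depends_only_on_def by blast
      ultimately show "?r us \<omega> = ?r us \<omega>'" by simp
    qed
    moreover have "{u. snd u \<le> m} \<inter> {u. snd ((0 :: 'a \<times> nat) + sum_list us) < snd u
        \<and> snd u \<le> snd ((0 :: 'a \<times> nat) + sum_list us) + n} = {}"
      using snd_sum_list_walk[OF us] by auto
    ultimately have "(\<integral>\<eta>. ?r us \<eta> * ?l us \<eta> \<partial>iid q) = (\<integral>\<eta>. ?r us \<eta> \<partial>iid q) * (\<integral>\<eta>. ?l us \<eta> \<partial>iid q)"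
      by (intro integral_iid_mult[OF rm _ r01[OF us] measurable_log_count log_count_depends abs_log_count_le[OF K]])
    then show ?thesis by (simp add: integral_log_count)
  qed
  have "(\<Sum>us\<in>walks m. \<integral>\<eta>. ?r us \<eta> \<partial>iid q) = (\<integral>\<eta>. (\<Sum>us\<in>walks m. ?r us \<eta>) \<partial>iid q)"
    by (rule Bochner_Integration.integral_sum[symmetric, OF rI])
  also have "\<dots> = 1" using prob_space by (simp add: sum_walk_probabilities)
  finally have one: "(\<Sum>us\<in>walks m. \<integral>\<eta>. ?r us \<eta> \<partial>iid q) = 1" .
  have "mean_log_count q K A m + mean_log_count q K B n
      = mean_log_count q K A m + (\<Sum>us\<in>walks m. \<integral>\<eta>. ?r us \<eta> * ?l us \<eta> \<partial>iid q)"
  proof -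
    have "(\<Sum>us\<in>walks m. \<integral>\<eta>. ?r us \<eta> * ?l us \<eta> \<partial>iid q)
        = (\<Sum>us\<in>walks m. \<integral>\<eta>. ?r us \<eta> \<partial>iid q) * mean_log_count q K B n"
      unfolding sum_distrib_right by (rule sum.cong[OF refl indep])
    then show ?thesis unfolding one by (simp only: mult_1)
  qed
  also have "(\<Sum>us\<in>walks m. \<integral>\<eta>. ?r us \<eta> * ?l us \<eta> \<partial>iid q) = (\<integral>\<eta>. (\<Sum>us\<in>walks m. ?r us \<eta> * ?l us \<eta>) \<partial>iid q)"
    by (rule Bochner_Integration.integral_sum[symmetric, OF rlI])
  also have "mean_log_count q K A m + \<dots> = (\<integral>\<eta>. log_count K A m 0 \<eta> + (\<Sum>us\<in>walks m. ?r us \<eta> * ?l us \<eta>) \<partial>iid q)"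
    unfolding mean_log_count_def
    by (rule Bochner_Integration.integral_add[symmetric, OF integrable_log_count[OF K]])
       (rule Bochner_Integration.integrable_sum[OF rlI])
  also have "\<dots> \<le> (\<integral>\<eta>. log_count K (A + B) (m + n) 0 \<eta> \<partial>iid q)"
    by (rule integral_mono[OF Bochner_Integration.integrable_add[OF integrable_log_count[OF K]
          Bochner_Integration.integrable_sum[OF rlI]] integrable_log_count[OF K] log_count_add_ge[OF K]])
  finally show ?thesis by (simp add: mean_log_count_def)
qed

lemma variance_log_count:
  assumes K: "K \<ge> 0"
  shows "(\<integral>\<eta>. (log_count K A n 0 \<eta> - mean_log_count q K A n)\<^sup>2 \<partial>iid q) \<le> real (Suc n) * K\<^sup>2"
  unfolding mean_log_count_def
proof (rule variance_bounded_differences[where level = snd, OF measurable_log_count abs_log_count_le[OF K]])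
  show "depends_only_on (log_count K A n (0 :: 'a \<times> nat)) {u. snd u < Suc n}"
    using log_count_depends[of K A n 0] unfolding depends_only_on_def by auto
qed (rule log_count_change_one_level[OF K])

section \<open>The exponential rate of the soft count\<close>

definition soft_rate :: "bool pmf \<Rightarrow> real \<Rightarrow> real \<Rightarrow> real" where
  "soft_rate q K \<alpha> = lim (\<lambda>n. mean_log_count q K (\<alpha> * real n) n / real n)"

lemma mean_log_count_le:
  assumes "K \<ge> 0" shows "mean_log_count q K A n \<le> real n * ln (real (card E))"
proof -
  interpret prob_space "iid q :: ('a \<times> nat \<Rightarrow> bool) measure" by (rule prob_space_iid)
  have "mean_log_count q K A n \<le> (\<integral>\<eta>. real n * ln (real (card E)) \<partial>(iid q :: ('a \<times> nat \<Rightarrow> bool) measure))"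
    unfolding mean_log_count_def
    by (rule integral_mono) (simp_all add: integrable_log_count log_count_le assms)
  then show ?thesis using prob_space by simp
qed

lemma mean_log_count_tendsto_soft_rate:
  assumes K: "K \<ge> 0"
  shows "(\<lambda>n. mean_log_count q K (\<alpha> * real n) n / real n) \<longlonglongrightarrow> soft_rate q K \<alpha>"
proof -
  have "convergent (\<lambda>n. mean_log_count q K (\<alpha> * real n) n / real n)"
  proof (rule superadditive_convergent)
    show "mean_log_count q K (\<alpha> * real m) m + mean_log_count q K (\<alpha> * real n) n
        \<le> mean_log_count q K (\<alpha> * real (m + n)) (m + n)" for m n
      using mean_log_count_add_ge[OF K, of q "\<alpha> * real m" m "\<alpha> * real n" n] by (simp add: algebra_simps)
    show "mean_log_count q K (\<alpha> * real n) n \<le> ln (real (card E)) * real n" for n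
      using mean_log_count_le[OF K] by (simp add: mult.commute)
  qed
  then show ?thesis unfolding soft_rate_def by (simp add: convergent_LIMSEQ_iff)
qed

text \<open>
  At time \<open>k\<^sup>2\<close> the normalised fluctuation has second moment at most of order \<open>1 / k\<^sup>2\<close>, which is
  summable; along all times the bound would be \<open>1 / n\<close>, hence the detour through squares.
\<close>

lemma AE_log_count_tendsto_soft_rate:
  assumes K: "K \<ge> 0"
  shows "AE \<eta> in iid q. (\<lambda>n. log_count K (\<alpha> * real n) n 0 \<eta> / real n) \<longlonglongrightarrow> soft_rate q K \<alpha>"
proof -
  let ?F = "\<lambda>n \<eta>. log_count K (\<alpha> * real n) n 0 \<eta>"
  let ?m = "\<lambda>n. mean_log_count q K (\<alpha> * real n) n"
  let ?Y = "\<lambda>k \<eta>. (?F (k\<^sup>2) \<eta> - ?m (k\<^sup>2)) / real (k\<^sup>2)"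
  have "AE \<eta> in iid q. (\<lambda>k. ?Y k \<eta>) \<longlonglongrightarrow> 0"
  proof (rule AE_tendsto_0_of_summable_second_moments)
    fix k
    let ?B = "real (k\<^sup>2) * ln (real (card E)) + K * max 0 (\<alpha> * real (k\<^sup>2)) + \<bar>?m (k\<^sup>2)\<bar>"
    have "\<bar>?F (k\<^sup>2) \<eta> - ?m (k\<^sup>2)\<bar> \<le> ?B" for \<eta>
      using abs_log_count_le[OF K, of "\<alpha> * real (k\<^sup>2)" "k\<^sup>2" 0 \<eta>] by linarith
    then have "\<bar>(?F (k\<^sup>2) \<eta> - ?m (k\<^sup>2))\<^sup>2\<bar> \<le> ?B\<^sup>2" for \<eta>
      by (simp add: abs_le_square_iff[symmetric] order_trans[OF _ abs_ge_self])
    then have "integrable (iid q) (\<lambda>\<eta>. (?F (k\<^sup>2) \<eta> - ?m (k\<^sup>2))\<^sup>2)"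
      by (intro integrable_iid_bounded[where B = "?B\<^sup>2"]) measurable
    then show "integrable (iid q) (\<lambda>\<eta>. (?Y k \<eta>)\<^sup>2)"
      unfolding power_divide by (rule integrable_divide)
    have "(\<integral>\<eta>. (?Y k \<eta>)\<^sup>2 \<partial>iid q) \<le> real (Suc (k\<^sup>2)) * K\<^sup>2 / (real (k\<^sup>2))\<^sup>2"
      unfolding power_divide integral_divide_zero
      by (rule divide_right_mono[OF variance_log_count[OF K]]) simp
    also have "\<dots> \<le> 2 * K\<^sup>2 * inverse ((real k)\<^sup>2)"
    proof (cases "k = 0")
      case False
      have "real (Suc (k\<^sup>2)) * K\<^sup>2 \<le> (2 * (real k)\<^sup>2) * K\<^sup>2"
        using False by (intro mult_right_mono) (auto simp: one_le_power)
      then have "real (Suc (k\<^sup>2)) * K\<^sup>2 / (real (k\<^sup>2))\<^sup>2 \<le> (2 * (real k)\<^sup>2) * K\<^sup>2 / (real (k\<^sup>2))\<^sup>2"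
        by (rule divide_right_mono) simp
      also have "\<dots> = 2 * K\<^sup>2 * inverse ((real k)\<^sup>2)"
        using False by (simp add: power2_eq_square field_simps)
      finally show ?thesis .
    qed simp
    finally show "(\<integral>\<eta>. (?Y k \<eta>)\<^sup>2 \<partial>iid q) \<le> 2 * K\<^sup>2 * inverse ((real k)\<^sup>2)" .
  next
    show "summable (\<lambda>k. 2 * K\<^sup>2 * inverse ((real k)\<^sup>2))"
      by (intro summable_mult inverse_power_summable) simp
  qed
  then show ?thesis
  proof eventually_elim
    case (elim \<eta>)
    have "filterlim (\<lambda>k::nat. k\<^sup>2) at_top sequentially"
      by (rule filterlim_subseq) (auto simp: strict_mono_def intro: power_strict_mono)
    from tendsto_add[OF elim filterlim_compose[OF mean_log_count_tendsto_soft_rate[OF K, of q \<alpha>] this]]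
    have "(\<lambda>k. ?F (k\<^sup>2) \<eta> / real (k\<^sup>2)) \<longlonglongrightarrow> soft_rate q K \<alpha>"
      by (simp add: diff_divide_distrib)
    then show ?case
    proof (rule tendsto_of_tendsto_along_squares[rotated])
      fix m n
      have "max 0 (\<alpha> * real n) = max 0 \<alpha> * real n"
        by (simp add: max_def zero_le_mult_iff mult_nonpos_nonneg)
      moreover have "\<alpha> * real m + \<alpha> * real n = \<alpha> * real (m + n)" by (simp add: distrib_left)
      ultimately show "?F m \<eta> - K * max 0 \<alpha> * real n \<le> ?F (m + n) \<eta>"
        using log_count_add_ge_crude[OF K, of "\<alpha> * real m" m 0 \<eta> "\<alpha> * real n" n] by (simp add: mult.assoc)
    qed
  qed
qed

section \<open>The largest density of hits, and the hard count\<close>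

definition hard_count :: "real \<Rightarrow> nat \<Rightarrow> ('a \<times> nat \<Rightarrow> bool) \<Rightarrow> nat" where
  "hard_count A n \<eta> = card {us \<in> walks n. A \<le> real (hits \<eta> 0 us)}"

definition max_hits :: "nat \<Rightarrow> ('a \<times> nat \<Rightarrow> bool) \<Rightarrow> nat" where
  "max_hits n \<eta> = Max (hits \<eta> 0 ` walks n)"

lemma hits_le_max_hits: "us \<in> walks n \<Longrightarrow> hits \<eta> 0 us \<le> max_hits n \<eta>"
  unfolding max_hits_def using finite_walks by (intro Max_ge) auto

lemma max_hits_attained: obtains us where "us \<in> walks n" "hits \<eta> 0 us = max_hits n \<eta>"
proof -
  have "max_hits n \<eta> \<in> hits \<eta> 0 ` walks n"
    unfolding max_hits_def using finite_walks walks_nonempty by (intro Max_in) auto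
  then show ?thesis using that by force
qed

lemma hard_count_le_soft_count: "real (hard_count A n \<eta>) \<le> soft_count K A n 0 \<eta>"
proof -
  have "real (hard_count A n \<eta>) = (\<Sum>us\<in>{us \<in> walks n. A \<le> real (hits \<eta> 0 us)}. weight K A 0 us \<eta>)"
    by (simp add: hard_count_def weight_def)
  also have "\<dots> \<le> soft_count K A n 0 \<eta>"
    unfolding soft_count_def by (rule sum_mono2) (auto simp: finite_walks less_imp_le[OF weight_pos])
  finally show ?thesis .
qed

text \<open>
  Walks below the threshold \<open>A\<close> miss a larger threshold \<open>A'\<close> by at least \<open>A' - A\<close>, so the penalty
  makes them negligible once \<open>K\<close> is large.
\<close>

lemma soft_count_le_hard_count:
  assumes "K \<ge> 0"
  shows "soft_count K A' n 0 \<eta> \<le> real (hard_count A n \<eta>) + real (card E) ^ n * exp (- K * (A' - A))"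
proof -
  let ?G = "{us \<in> walks n. A \<le> real (hits \<eta> 0 us)}"
  have "soft_count K A' n 0 \<eta> \<le> (\<Sum>us\<in>walks n. (if A \<le> real (hits \<eta> 0 us) then 1 else 0) + exp (- K * (A' - A)))"
    unfolding soft_count_def
  proof (rule sum_mono)
    fix us
    show "weight K A' 0 us \<eta> \<le> (if A \<le> real (hits \<eta> 0 us) then 1 else 0) + exp (- K * (A' - A))"
    proof (cases "A \<le> real (hits \<eta> 0 us)")
      case True
      then show ?thesis using weight_le_1[OF assms, of A' 0 us \<eta>] by (simp add: add_increasing2)
    next
      case False
      then have "K * (A' - A) \<le> K * max 0 (A' - real (hits \<eta> 0 us))" by (intro mult_left_mono assms) linarith
      then show ?thesis using False by (simp add: weight_def)
    qed
  qed
  also have "\<dots> = real (card ?G) + real (card E) ^ n * exp (- K * (A' - A))"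
    by (simp add: sum.distrib card_walks sum.If_cases finite_walks Int_def)
  finally show ?thesis by (simp add: hard_count_def)
qed

lemma log_count_nonneg:
  assumes "A \<le> real (max_hits n \<eta>)"
  shows "log_count K A n 0 \<eta> \<ge> 0"
proof -
  obtain us where us: "us \<in> walks n" "hits \<eta> 0 us = max_hits n \<eta>" by (rule max_hits_attained)
  have "weight K A 0 us \<eta> = 1" using us assms by (simp add: weight_def)
  then show ?thesis using weight_le_soft_count[OF us(1), of K A 0 \<eta>] by (simp add: log_count_def)
qed

text \<open>
  For the threshold \<open>n\<close> itself the positive part is linear on all walks, and the soft count is, up to a
  factor of at most \<open>card E ^ n\<close>, its largest term.
\<close>

lemma max_hits_bounds:
  fixes \<eta> :: "'a \<times> nat \<Rightarrow> bool"
  assumes K: "K > 0" and n: "n \<ge> 1"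
  defines "y \<equiv> log_count K (1 * real n) n 0 \<eta> / real n / K + 1"
  shows "real (max_hits n \<eta>) / real n \<le> y" "y - ln (real (card E)) / K \<le> real (max_hits n \<eta>) / real n"
proof -
  let ?T = "max_hits n \<eta>" and ?F = "log_count K (1 * real n) n 0 \<eta>" and ?L = "ln (real (card E))"
  have w: "weight K (1 * real n) 0 us \<eta> = exp (- K * (real n - real (hits \<eta> 0 us)))" if "us \<in> walks n" for us
    using hits_le_length[of \<eta> 0 us] that by (simp add: weight_def walks_def max_def)
  obtain us where us: "us \<in> walks n" "hits \<eta> 0 us = ?T" by (rule max_hits_attained)
  have "ln (weight K (1 * real n) 0 us \<eta>) \<le> ?F"
    unfolding log_count_def by (rule ln_mono[OF weight_le_soft_count[OF us(1)] weight_pos])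
  then have low: "- K * (real n - real ?T) \<le> ?F" unfolding w[OF us(1)] us(2) by simp
  have "soft_count K (1 * real n) n 0 \<eta> \<le> (\<Sum>us\<in>walks n. exp (- K * (real n - real ?T)))"
    unfolding soft_count_def
  proof (rule sum_mono)
    fix us assume us: "us \<in> walks n"
    have "K * (real n - real ?T) \<le> K * (real n - real (hits \<eta> 0 us))"
      using hits_le_max_hits[OF us, of \<eta>] K by (intro mult_left_mono) auto
    then show "weight K (1 * real n) 0 us \<eta> \<le> exp (- K * (real n - real ?T))" unfolding w[OF us] by simp
  qed
  also have "\<dots> = real (card E) ^ n * exp (- K * (real n - real ?T))" by (simp add: card_walks)
  finally have "?F \<le> ln (real (card E) ^ n * exp (- K * (real n - real ?T)))"
    unfolding log_count_def by (rule ln_mono[OF _ soft_count_pos])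
  also have "\<dots> = real n * ?L - K * (real n - real ?T)"
    using card_E_ge_1 by (simp add: ln_mult ln_realpow)
  finally have up: "?F \<le> real n * ?L - K * (real n - real ?T)" .
  show "real ?T / real n \<le> y" "y - ?L / K \<le> real ?T / real n"
  proof -
    have pos: "0 \<le> K * real n" using K by simp
    have T: "real ?T / real n = (K * real ?T) / (K * real n)" using K by simp
    have y: "y = (?F + K * real n) / (K * real n)"
      using K n unfolding y_def by (simp add: add_divide_distrib mult.commute)
    have "?L / K = (real n * ?L) / (K * real n)" using n by (simp add: mult.commute)
    then have yL: "y - ?L / K = (?F + K * real n - real n * ?L) / (K * real n)"
      unfolding y by (simp add: diff_divide_distrib)
    show "real ?T / real n \<le> y"
      unfolding T y using low by (intro divide_right_mono pos) (simp add: algebra_simps)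
    show "y - ?L / K \<le> real ?T / real n"
      unfolding T yL using up by (intro divide_right_mono pos) (simp add: algebra_simps)
  qed
qed

lemma soft_rate_ge:
  assumes "K \<ge> 0"
  shows "- K * max 0 \<alpha> \<le> soft_rate q K \<alpha>"
proof (rule LIMSEQ_le_const[OF mean_log_count_tendsto_soft_rate[OF assms]], intro exI allI impI)
  fix n :: nat assume n: "1 \<le> n"
  interpret prob_space "iid q :: ('a \<times> nat \<Rightarrow> bool) measure" by (rule prob_space_iid)
  have "(\<integral>\<eta>. - K * max 0 (\<alpha> * real n) \<partial>(iid q :: ('a \<times> nat \<Rightarrow> bool) measure)) \<le> mean_log_count q K (\<alpha> * real n) n"
    unfolding mean_log_count_def
    by (rule integral_mono) (simp_all add: integrable_log_count log_count_ge[simplified] assms)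
  then have "- K * max 0 (\<alpha> * real n) \<le> mean_log_count q K (\<alpha> * real n) n" using prob_space by simp
  moreover have "max 0 (\<alpha> * real n) = max 0 \<alpha> * real n" by (simp add: max_def zero_le_mult_iff mult_nonpos_nonneg)
  ultimately show "- K * max 0 \<alpha> \<le> mean_log_count q K (\<alpha> * real n) n / real n"
    using n by (simp add: pos_le_divide_eq mult.assoc)
qed

text \<open>
  Each member of the family lies above the limiting density, by at most \<open>ln (card E) / K\<close>, so the
  infimum is the limiting density. The index 0 is excluded because of the
  division by \<open>K\<close>.
\<close>

definition max_hit_density :: "bool pmf \<Rightarrow> real" where
  "max_hit_density q = (INF K\<in>{1::nat..}. soft_rate q (real K) 1 / real K + 1)"

lemma AE_max_hits_tendsto:
  "AE \<eta> in iid q. (\<lambda>n. real (max_hits n \<eta>) / real n) \<longlonglongrightarrow> max_hit_density q"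
proof -
  have bdd: "bdd_below ((\<lambda>K. soft_rate q (real K) 1 / real K + 1) ` {1::nat..})"
  proof (rule bdd_belowI)
    fix x assume "x \<in> (\<lambda>K. soft_rate q (real K) 1 / real K + 1) ` {1::nat..}"
    then obtain K :: nat where K: "K \<ge> 1" "x = soft_rate q (real K) 1 / real K + 1" by auto
    have "- real K \<le> soft_rate q (real K) 1" using soft_rate_ge[of "real K" 1 q] by simp
    then have "- 1 \<le> soft_rate q (real K) 1 / real K" using K(1) by (simp add: pos_le_divide_eq)
    then show "0 \<le> x" using K(2) by simp
  qed
  let ?y = "\<lambda>\<eta> K n. log_count (real K) (1 * real n) n 0 \<eta> / real n / real K + 1"
  have "AE \<eta> in iid q. \<forall>K::nat. (\<lambda>n. log_count (real K) (1 * real n) n 0 \<eta> / real n) \<longlonglongrightarrow> soft_rate q (real K) 1"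
    unfolding AE_all_countable by (intro allI AE_log_count_tendsto_soft_rate) simp
  then show ?thesis
  proof eventually_elim
    case (elim \<eta>)
    have y: "?y \<eta> K \<longlonglongrightarrow> soft_rate q (real K) 1 / real K + 1" if "K \<ge> 1" for K
      using that by (intro tendsto_add tendsto_divide elim[rule_format] tendsto_const) simp
    show ?case
    proof (rule order_tendstoI)
      fix a assume a: "a < max_hit_density q"
      obtain K :: nat where K: "ln (real (card E)) / (max_hit_density q - a) < real K" using reals_Archimedean2 by blast
      have "0 \<le> ln (real (card E)) / (max_hit_density q - a)" using a card_E_ge_1 by simp
      then have K1: "K \<ge> 1" using K by (cases K) auto
      have "ln (real (card E)) / real K < max_hit_density q - a" using K K1 a by (simp add: field_simps)
      moreover have "max_hit_density q \<le> soft_rate q (real K) 1 / real K + 1"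
        unfolding max_hit_density_def by (rule cINF_lower[OF bdd]) (use K1 in simp)
      ultimately have "a + ln (real (card E)) / real K < soft_rate q (real K) 1 / real K + 1" by linarith
      from order_tendstoD(1)[OF y[OF K1] this] eventually_ge_at_top[of 1]
      show "\<forall>\<^sub>F n in sequentially. a < real (max_hits n \<eta>) / real n"
      proof eventually_elim
        case (elim n)
        then show ?case using max_hits_bounds(2)[of "real K" n \<eta>] K1 by simp
      qed
    next
      fix a assume "max_hit_density q < a"
      then obtain K :: nat where K: "K \<ge> 1" "soft_rate q (real K) 1 / real K + 1 < a"
        unfolding max_hit_density_def by (subst (asm) cINF_less_iff) (use bdd in auto)
      from order_tendstoD(2)[OF y[OF K(1)] K(2)] eventually_ge_at_top[of 1]
      show "\<forall>\<^sub>F n in sequentially. real (max_hits n \<eta>) / real n < a"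
      proof eventually_elim
        case (elim n)
        then show ?case using max_hits_bounds(1)[of "real K" n \<eta>] K by simp
      qed
    qed
  qed
qed

text \<open>
  Below the maximal density some walk eventually meets the threshold and contributes 1 to the soft count. The
  rate is deterministic, so an almost sure bound is a bound.
\<close>

lemma soft_rate_nonneg:
  assumes "K \<ge> 0" "\<alpha> < max_hit_density q"
  shows "soft_rate q K \<alpha> \<ge> 0"
proof -
  interpret prob_space "iid q :: ('a \<times> nat \<Rightarrow> bool) measure" by (rule prob_space_iid)
  have "AE \<eta> in (iid q :: ('a \<times> nat \<Rightarrow> bool) measure). soft_rate q K \<alpha> \<ge> 0"
    using AE_max_hits_tendsto[of q] AE_log_count_tendsto_soft_rate[OF assms(1), where q = q and \<alpha> = \<alpha>]
  proof eventually_elim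
    case (elim \<eta>)
    have "\<forall>\<^sub>F n in sequentially. 0 \<le> log_count K (\<alpha> * real n) n 0 \<eta> / real n"
      using order_tendstoD(1)[OF elim(1) assms(2)] eventually_ge_at_top[of 1]
    proof eventually_elim
      case (elim n)
      then show ?case by (intro divide_nonneg_nonneg log_count_nonneg) (auto simp: field_simps)
    qed
    then show ?case by (intro tendsto_lowerbound[OF elim(2)]) auto
  qed
  then show ?thesis by simp
qed

text \<open>
  Following threshold \<open>\<alpha>\<close> for \<open>n\<close> steps and then threshold \<open>\<beta>\<close> for \<open>n\<close> steps is one way of meeting the
  average threshold in \<open>2n\<close> steps.
\<close>

lemma soft_rate_midpoint:
  assumes K: "K \<ge> 0"
  shows "(soft_rate q K \<alpha> + soft_rate q K \<beta>) / 2 \<le> soft_rate q K ((\<alpha> + \<beta>) / 2)"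
proof (rule LIMSEQ_le)
  let ?m = "\<lambda>\<alpha> n. mean_log_count q K (\<alpha> * real n) n / real n"
  show "(\<lambda>n. (?m \<alpha> n + ?m \<beta> n) / 2) \<longlonglongrightarrow> (soft_rate q K \<alpha> + soft_rate q K \<beta>) / 2"
    by (intro tendsto_intros mean_log_count_tendsto_soft_rate K) simp
  have "filterlim (\<lambda>n::nat. 2 * n) at_top sequentially"
    by (rule filterlim_subseq) (auto simp: strict_mono_def)
  from filterlim_compose[OF mean_log_count_tendsto_soft_rate[OF K] this]
  show "(\<lambda>n. ?m ((\<alpha> + \<beta>) / 2) (2 * n)) \<longlonglongrightarrow> soft_rate q K ((\<alpha> + \<beta>) / 2)" .
  show "\<exists>N. \<forall>n\<ge>N. (?m \<alpha> n + ?m \<beta> n) / 2 \<le> ?m ((\<alpha> + \<beta>) / 2) (2 * n)"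
  proof (intro exI allI impI)
    fix n :: nat assume n: "1 \<le> n"
    have "mean_log_count q K (\<alpha> * real n) n + mean_log_count q K (\<beta> * real n) n
        \<le> mean_log_count q K ((\<alpha> + \<beta>) / 2 * real (2 * n)) (2 * n)"
    proof -
      have "(\<alpha> + \<beta>) / 2 * real (2 * n) = \<alpha> * real n + \<beta> * real n" "2 * n = n + n"
        by (simp_all add: distrib_right)
      then show ?thesis
        using mean_log_count_add_ge[OF K, of q "\<alpha> * real n" n "\<beta> * real n" n] by (simp only:)
    qed
    from divide_right_mono[OF this, of "2 * real n"]
    show "(?m \<alpha> n + ?m \<beta> n) / 2 \<le> ?m ((\<alpha> + \<beta>) / 2) (2 * n)"
      using n by (simp add: add_divide_distrib mult.commute)
  qed
qed

text \<open>
  Right continuity in a form that is uniform in \<open>K\<close>: repeated halving of the distance to \<open>\<alpha>\<close>, where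
  nonnegativity at \<open>\<alpha> + h\<close> is the only information on the right end.
\<close>

lemma soft_rate_dyadic:
  assumes K: "K \<ge> 0" and nonneg: "soft_rate q K (\<alpha> + h) \<ge> 0"
  shows "(1 - 1 / 2 ^ j) * soft_rate q K \<alpha> \<le> soft_rate q K (\<alpha> + h / 2 ^ j)"
proof (induction j)
  case (Suc j)
  have "(1 - 1 / 2 ^ Suc j) * soft_rate q K \<alpha> = (soft_rate q K \<alpha> + (1 - 1 / 2 ^ j) * soft_rate q K \<alpha>) / 2"
    by (simp add: field_simps)
  also have "\<dots> \<le> (soft_rate q K \<alpha> + soft_rate q K (\<alpha> + h / 2 ^ j)) / 2" using Suc by simp
  also have "\<dots> \<le> soft_rate q K ((\<alpha> + (\<alpha> + h / 2 ^ j)) / 2)" by (rule soft_rate_midpoint[OF K])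
  also have "(\<alpha> + (\<alpha> + h / 2 ^ j)) / 2 = \<alpha> + h / 2 ^ Suc j" by (simp add: field_simps)
  finally show ?case .
qed (use nonneg in simp)

text \<open>
  The infimum is over natural numbers so that one null set serves all \<open>K\<close>.
\<close>

definition hard_rate :: "bool pmf \<Rightarrow> real \<Rightarrow> real" where
  "hard_rate q \<alpha> = (INF K::nat. soft_rate q (real K) \<alpha>)"

text \<open>
  The deterministic core of the sandwich. The upper bound uses the threshold \<open>\<alpha>\<close> itself, the lower
  bound the slightly larger thresholds \<open>\<alpha> + h / 2 ^ j\<close>; both need only countably many limits.
\<close>

lemma hard_count_tendsto_of_log_count_tendsto:
  assumes below: "\<alpha> + h < max_hit_density q" "h > 0"
    and lim: "\<And>K. (\<lambda>n. log_count (real K) (\<alpha> * real n) n 0 \<eta> / real n) \<longlonglongrightarrow> soft_rate q (real K) \<alpha>"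
    and lim': "\<And>K j. (\<lambda>n. log_count (real K) ((\<alpha> + h / 2 ^ j) * real n) n 0 \<eta> / real n)
        \<longlonglongrightarrow> soft_rate q (real K) (\<alpha> + h / 2 ^ j)"
  shows "(\<lambda>n. real (hard_count (\<alpha> * real n) n \<eta>) powr (1 / real n)) \<longlonglongrightarrow> exp (hard_rate q \<alpha>)"
proof -
  let ?c = "\<lambda>n. real (hard_count (\<alpha> * real n) n \<eta>)"
  let ?L = "ln (real (card E))"
  have nonneg: "soft_rate q (real K) (\<alpha> + h / 2 ^ j) \<ge> 0" for K j
  proof (rule soft_rate_nonneg)
    have "h / 2 ^ j \<le> h / 1" using below(2) by (intro divide_left_mono) auto
    then show "\<alpha> + h / 2 ^ j < max_hit_density q" using below(1) by simp
  qed simp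
  have nonneg0: "soft_rate q (real K) \<alpha> \<ge> 0" for K
    by (rule soft_rate_nonneg) (use below in auto)
  have bdd: "bdd_below (range (\<lambda>K::nat. soft_rate q (real K) \<alpha>))"
    by (rule bdd_belowI2[of _ 0]) (rule nonneg0)
  have g0: "hard_rate q \<alpha> \<ge> 0" unfolding hard_rate_def by (rule cINF_greatest) (auto intro: nonneg0)
  have low: "\<forall>\<^sub>F n in sequentially. ?c n > 0 \<and> a < ln (?c n) / real n" if a: "a < hard_rate q \<alpha>" for a
  proof -
    have "(\<lambda>j. (1 - (1 / 2) ^ j) * hard_rate q \<alpha>) \<longlonglongrightarrow> (1 - 0) * hard_rate q \<alpha>"
      by (intro tendsto_intros LIMSEQ_power_zero) simp
    then have "\<forall>\<^sub>F j in sequentially. a < (1 - (1 / 2) ^ j) * hard_rate q \<alpha>"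
      by (rule order_tendstoD(1)) (use a in simp)
    then obtain j where j: "a < (1 - 1 / 2 ^ j) * hard_rate q \<alpha>"
      by (auto simp: eventually_sequentially power_one_over)
    define \<delta> where "\<delta> = h / 2 ^ j"
    have \<delta>: "\<delta> > 0" using below(2) by (simp add: \<delta>_def)
    (* With this K the walks below the threshold contribute at most exp (- n). *)
    obtain K :: nat where K: "(?L + 1) / \<delta> < real K" using reals_Archimedean2 by blast
    then have K\<delta>: "?L + 1 \<le> real K * \<delta>" using \<delta> by (simp add: field_simps)
    define r where "r = soft_rate q (real K) (\<alpha> + \<delta>)"
    have "a < (1 - 1 / 2 ^ j) * hard_rate q \<alpha>" by (rule j)
    also have "\<dots> \<le> (1 - 1 / 2 ^ j) * soft_rate q (real K) \<alpha>"
      unfolding hard_rate_def by (intro mult_left_mono cINF_lower[OF bdd]) auto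
    also have "\<dots> \<le> r"
      unfolding r_def \<delta>_def using nonneg[of K 0] by (intro soft_rate_dyadic) auto
    finally have ar: "a < r" .
    have r0: "r \<ge> 0" unfolding r_def \<delta>_def by (rule nonneg)
    (* The growth exponent c stays above - 1 / 2, so that exp (c n) dominates exp (- n). *)
    define c where "c = (max a (- 1 / 2) + r) / 2"
    have c: "a < c" "- 1 / 2 < c" "c < r" using ar r0 by (auto simp: c_def)
    have "\<forall>\<^sub>F n in sequentially. c < log_count (real K) ((\<alpha> + \<delta>) * real n) n 0 \<eta> / real n"
      by (rule order_tendstoD(1)[OF lim'[of K j, folded \<delta>_def, folded r_def] c(3)])
    moreover have "(\<lambda>n. c - ln 2 / real n) \<longlonglongrightarrow> c - 0" by (intro tendsto_intros lim_const_over_n)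
    then have "\<forall>\<^sub>F n in sequentially. a < c - ln 2 / real n" by (rule order_tendstoD(1)) (use c in simp)
    ultimately show ?thesis using eventually_ge_at_top[of 2]
    proof eventually_elim
      case (elim n)
      have n: "real n \<ge> 2" using elim(3) by linarith
      have "c * real n \<le> log_count (real K) ((\<alpha> + \<delta>) * real n) n 0 \<eta>"
        using elim(1) n by (simp add: field_simps)
      then have "exp (c * real n) \<le> soft_count (real K) ((\<alpha> + \<delta>) * real n) n 0 \<eta>"
        unfolding log_count_def using soft_count_pos by (subst (asm) ln_ge_iff)
      also have "\<dots> \<le> ?c n + real (card E) ^ n * exp (- real K * ((\<alpha> + \<delta>) * real n - \<alpha> * real n))"
        by (rule soft_count_le_hard_count) simp
      also have "real (card E) ^ n * exp (- real K * ((\<alpha> + \<delta>) * real n - \<alpha> * real n)) \<le> exp (c * real n) / 2"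
      proof -
        have "real (card E) ^ n = exp (?L * real n)"
          using card_E_ge_1 by (simp add: exp_of_nat2_mult)
        then have "real (card E) ^ n * exp (- real K * ((\<alpha> + \<delta>) * real n - \<alpha> * real n))
            = exp ((?L - real K * \<delta>) * real n)"
          by (simp add: exp_add[symmetric] algebra_simps)
        also have "\<dots> \<le> exp (c * real n - 1)"
        proof -
          have "(?L - real K * \<delta>) * real n \<le> - 1 * real n"
            using K\<delta> n by (intro mult_right_mono) auto
          moreover have "- 1 / 2 * real n \<le> c * real n" using c(2) n by (intro mult_right_mono) auto
          ultimately show ?thesis using n unfolding exp_le_cancel_iff by linarith
        qed
        also have "\<dots> = exp (c * real n) / exp 1" by (simp add: exp_diff)
        also have "\<dots> \<le> exp (c * real n) / 2"
          using exp_ge_add_one_self[of 1] by (intro divide_left_mono) auto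
        finally show ?thesis .
      qed
      finally have *: "exp (c * real n) / 2 \<le> ?c n" by simp
      have pos: "0 < exp (c * real n) / 2" by simp
      have "ln (exp (c * real n) / 2) \<le> ln (?c n)" using * pos by (intro ln_mono) linarith+
      then have "c * real n - ln 2 \<le> ln (?c n)" by (simp add: ln_div)
      from divide_right_mono[OF this, of "real n"] have "c - ln 2 / real n \<le> ln (?c n) / real n"
        using n by (simp add: diff_divide_distrib)
      then show ?case using elim(2) * pos by linarith
    qed
  qed
  have pos: "\<forall>\<^sub>F n in sequentially. ?c n > 0"
    using low[of "hard_rate q \<alpha> - 1"] by (auto elim: eventually_mono)
  have "(\<lambda>n. ln (?c n) / real n) \<longlonglongrightarrow> hard_rate q \<alpha>"
  proof (rule order_tendstoI)
    fix a assume "a < hard_rate q \<alpha>"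
    then show "\<forall>\<^sub>F n in sequentially. a < ln (?c n) / real n" using low[of a] by (auto elim: eventually_mono)
  next
    fix a assume "hard_rate q \<alpha> < a"
    then obtain K :: nat where K: "soft_rate q (real K) \<alpha> < a"
      unfolding hard_rate_def using bdd by (subst (asm) cINF_less_iff) auto
    from order_tendstoD(2)[OF lim K] pos show "\<forall>\<^sub>F n in sequentially. ln (?c n) / real n < a"
    proof eventually_elim
      case (elim n)
      have "ln (?c n) \<le> log_count (real K) (\<alpha> * real n) n 0 \<eta>"
        unfolding log_count_def using elim(2) by (intro ln_mono hard_count_le_soft_count)
      from divide_right_mono[OF this, of "real n"] show ?case using elim(1) by simp
    qed
  qed
  then have "(\<lambda>n. exp (ln (?c n) / real n)) \<longlonglongrightarrow> exp (hard_rate q \<alpha>)" by (rule tendsto_exp)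
  moreover have "\<forall>\<^sub>F n in sequentially. exp (ln (?c n) / real n) = ?c n powr (1 / real n)"
    using pos by eventually_elim (simp add: powr_def)
  ultimately show ?thesis by (simp add: tendsto_cong)
qed

lemma AE_hard_count_tendsto_below:
  assumes "\<alpha> < max_hit_density q"
  shows "AE \<eta> in iid q. (\<lambda>n. real (hard_count (\<alpha> * real n) n \<eta>) powr (1 / real n)) \<longlonglongrightarrow> exp (hard_rate q \<alpha>)"
proof -
  define h where "h = (max_hit_density q - \<alpha>) / 2"
  have h: "\<alpha> + h < max_hit_density q" "h > 0" using assms by (auto simp: h_def field_simps)
  have "AE \<eta> in iid q. \<forall>K::nat. (\<lambda>n. log_count (real K) (\<alpha> * real n) n 0 \<eta> / real n) \<longlonglongrightarrow> soft_rate q (real K) \<alpha>"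
    unfolding AE_all_countable by (intro allI AE_log_count_tendsto_soft_rate) simp
  moreover have "AE \<eta> in iid q. \<forall>K j::nat. (\<lambda>n. log_count (real K) ((\<alpha> + h / 2 ^ j) * real n) n 0 \<eta> / real n)
        \<longlonglongrightarrow> soft_rate q (real K) (\<alpha> + h / 2 ^ j)"
    unfolding AE_all_countable by (intro allI AE_log_count_tendsto_soft_rate) simp
  ultimately show ?thesis
    by eventually_elim (rule hard_count_tendsto_of_log_count_tendsto[OF h], blast+)
qed

lemma AE_hard_count_tendsto_above:
  assumes "max_hit_density q < \<alpha>"
  shows "AE \<eta> in iid q. (\<lambda>n. real (hard_count (\<alpha> * real n) n \<eta>) powr (1 / real n)) \<longlonglongrightarrow> 0"
  using AE_max_hits_tendsto[of q]
proof eventually_elim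
  case (elim \<eta>)
  have "\<forall>\<^sub>F n in sequentially. real (hard_count (\<alpha> * real n) n \<eta>) powr (1 / real n) = 0"
    using order_tendstoD(2)[OF elim assms] eventually_ge_at_top[of 1]
  proof eventually_elim
    case (elim n)
    then have "real (max_hits n \<eta>) < \<alpha> * real n" by (simp add: field_simps)
    then have "{us \<in> walks n. \<alpha> * real n \<le> real (hits \<eta> 0 us)} = {}"
      using hits_le_max_hits[of _ n \<eta>] by fastforce
    then have "hard_count (\<alpha> * real n) n \<eta> = 0" unfolding hard_count_def by (simp only: card.empty)
    then show ?case by simp
  qed
  then show ?case by (rule tendsto_eventually)
qed

end

section \<open>Oriented paths of the lattice as walks\<close>

definition unit_steps :: "('d::finite) vertex set" where
  "unit_steps = range (\<lambda>i. (axis i 1, 1)) \<union> range (\<lambda>i. (- axis i 1, 1))"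

interpretation lattice: oriented_walks "unit_steps :: ('d::finite) vertex set"
  by unfold_locales (auto simp: unit_steps_def)

primrec visited :: "'v::monoid_add \<Rightarrow> 'v list \<Rightarrow> 'v list" where
  "visited v [] = [v]"
| "visited v (e # us) = v # visited (v + e) us"

lemma edge_iff_step: "edge u v \<longleftrightarrow> (\<exists>e\<in>unit_steps. v = u + e)"
  by (auto simp: edge_def unit_steps_def prod_eq_iff bex_Un)

lemma visited_nonempty: "visited v us \<noteq> []"
  by (cases us) auto

lemma hd_visited: "hd (visited v us) = v"
  by (cases us) auto

lemma visited_snoc: "visited v (us @ [e]) = visited v us @ [v + sum_list us + e]"
  by (induction us arbitrary: v) (simp_all add: add.assoc)

lemma last_visited: "last (visited v us) = v + sum_list us"
  by (induction us arbitrary: v) (simp_all add: add.assoc visited_nonempty)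

lemma inj_visited: "visited v us = visited v vs \<Longrightarrow> us = (vs :: 'v::cancel_comm_monoid_add list)"
proof (induction us arbitrary: v vs)
  case Nil
  then show ?case by (cases vs) (auto simp: visited_nonempty dest: sym)
next
  case (Cons e us)
  then obtain f ws where vs: "vs = f # ws" by (cases vs) (auto simp: visited_nonempty)
  with Cons.prems have *: "visited (v + e) us = visited (v + f) ws" by simp
  then have "v + e = v + f" by (metis hd_visited)
  then have "e = f" by simp
  then show ?case using Cons.IH * vs by simp
qed

lemma W_snoc: "\<pi> \<noteq> [] \<Longrightarrow> W b x (\<pi> @ [v]) = W b x \<pi> + of_bool (x v = exp b)"
proof -
  assume ne: "\<pi> \<noteq> []"
  let ?S = "{i. 1 \<le> i \<and> i < length \<pi> \<and> x (\<pi> ! i) = exp b}"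
  have "{i. 1 \<le> i \<and> i < length (\<pi> @ [v]) \<and> x ((\<pi> @ [v]) ! i) = exp b}
      = (if x v = exp b then insert (length \<pi>) ?S else ?S)"
    using ne by (auto simp: nth_append less_Suc_eq Suc_le_eq)
  moreover have "finite ?S" by (rule finite_subset[of _ "{..<length \<pi>}"]) auto
  ultimately show ?thesis unfolding W_def by simp
qed

lemma W_visited: "W b x (visited v us) = hits (\<lambda>u. x u = exp b) v us"
proof (induction us rule: rev_induct)
  case Nil
  then show ?case by (auto simp: W_def)
next
  case (snoc e us)
  then show ?case by (simp add: visited_snoc W_snoc visited_nonempty hits_append)
qed

lemma paths_eq_visited: "paths s = visited 0 ` (lattice.walks s :: ('d::finite) vertex list set)"
proof (induction s)
  case 0
  then show ?case by (simp add: paths_0 lattice.walks_0 origin_def zero_prod_def)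
next
  case (Suc s)
  have "lattice.walks (Suc s) = {us @ [e] |us e. us \<in> lattice.walks s \<and> e \<in> (unit_steps :: 'd vertex set)}" (is "_ = ?R")
  proof (intro equalityI subsetI)
    fix us assume "us \<in> (lattice.walks (Suc s) :: 'd vertex list set)"
    then show "us \<in> ?R" by (cases us rule: rev_cases) (auto simp: lattice.walks_def)
  qed (auto simp: lattice.walks_def)
  moreover have "(paths (Suc s) :: 'd vertex list set) = {visited 0 us @ [last (visited 0 us) + e] |us e.
      us \<in> lattice.walks s \<and> e \<in> unit_steps}"
    unfolding paths_Suc Suc.IH edge_iff_step by blast
  moreover have "\<dots> = visited 0 ` ?R"
    unfolding last_visited visited_snoc[symmetric] by blast
  ultimately show ?case by simp
qed

lemma N_eq_hard_count:
  fixes x :: "('d::finite) vertex \<Rightarrow> real"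
  shows "N b x s \<alpha> = lattice.hard_count (\<alpha> * real s) s (\<lambda>u. x u = exp b)"
proof -
  have "{\<pi> \<in> paths s. real (W b x \<pi>) \<ge> \<alpha> * real s}
      = visited 0 ` {us \<in> lattice.walks s. \<alpha> * real s \<le> real (hits (\<lambda>u. x u = exp b) 0 us)}"
    unfolding paths_eq_visited by (auto simp: W_visited)
  moreover have "inj_on (visited 0) (A :: 'd vertex list set)" for A
    using inj_visited by (auto simp: inj_on_def)
  ultimately show ?thesis unfolding N_def lattice.hard_count_def by (simp add: card_image)
qed

lemma max_density_eq_max_hits:
  fixes x :: "('d::finite) vertex \<Rightarrow> real"
  shows "max_density b x s = real (lattice.max_hits s (\<lambda>u. x u = exp b)) / real s"
proof -
  have "mono (\<lambda>k::nat. 1 / real s * real k)" by (intro monoI mult_left_mono) auto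
  moreover have "(lattice.walks s :: 'd vertex list set) \<noteq> {}" by (rule lattice.walks_nonempty)
  ultimately show ?thesis
    using mono_Max_commute[of "\<lambda>k::nat. 1 / real s * real k" "hits (\<lambda>u. x u = exp b) 0 ` lattice.walks s"]
    unfolding max_density_def lattice.max_hits_def paths_eq_visited
    by (simp add: image_image W_visited lattice.finite_walks)
qed

theorem lemma2:
  fixes P :: "'w measure"
    and X :: "('d::finite) vertex \<Rightarrow> 'w \<Rightarrow> real"
    and b p \<alpha> :: real
  assumes "prob_space P"
    and "0 < p" and "p < 1" and "b > 0"
    and "prob_space.indep_vars P (\<lambda>_. borel) X UNIV"
    and "\<And>v. measure P {\<omega> \<in> space P. X v \<omega> = exp b} = p"
    and "\<And>v. measure P {\<omega> \<in> space P. X v \<omega> = 1} = 1 - p"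
    and "\<alpha> \<ge> 0" and "\<alpha> \<noteq> M_const P b X"
  shows "\<exists>l::real. AE \<omega> in P.
    (\<lambda>t. real (N b (\<lambda>v. X v \<omega>) t \<alpha>) powr (1 / real t)) \<longlonglongrightarrow> l"
proof -
  let ?q = "bernoulli_pmf p" and ?\<eta> = "\<lambda>\<omega> v. X v \<omega> = exp b"
  have "{x \<in> space borel. x = exp b} \<in> sets borel" by simp
  note env = distr_indep_indicators[OF assms(1,5) this assms(6)]
  have transfer: "AE \<omega> in P. Q (?\<eta> \<omega>)" if "AE \<eta> in iid ?q. Q \<eta>" for Q
    by (rule AE_distrD[OF env(1)]) (unfold env(2), rule that)
  have "AE \<omega> in P. (\<lambda>s. max_density b (\<lambda>v. X v \<omega>) s) \<longlonglongrightarrow> oriented_walks.max_hit_density (unit_steps :: 'd vertex set) ?q"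
    unfolding max_density_eq_max_hits by (rule transfer[OF lattice.AE_max_hits_tendsto])
  then have M: "M_const P b X = oriented_walks.max_hit_density (unit_steps :: 'd vertex set) ?q"
    by (rule M_const_eqI[OF assms(1)])
  show ?thesis
  proof (cases "\<alpha> < M_const P b X")
    case True
    from transfer[OF lattice.AE_hard_count_tendsto_below[OF this[unfolded M]]]
    show ?thesis unfolding N_eq_hard_count by blast
  next
    case False
    with assms(9) have "M_const P b X < \<alpha>" by simp
    from transfer[OF lattice.AE_hard_count_tendsto_above[OF this[unfolded M]]]
    show ?thesis unfolding N_eq_hard_count by blast
  qed
qed

end
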